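(* Assume (P1)–(P4), let $1\le k\le n$ and $\lambda=(k-1)m$. The map \[\tau:\ \mathfrak C(\lambda P^{(0)}_\infty,\mathcal P)\to \mathrm{IRS}_m(\lambda P^{(0)}_\infty,\mathcal P),\qquad \mathrm{ev}_{\mathcal P}(f)\mapsto \mathsf C_f,\] is well defined and is a bijection.
   Context: $E/\mathbb{F}_q$ is an algebraic function field with full constant field $\mathbb{F}_q$ containing $F=\mathbb{F}_q(x)$, $[E:F]=m=p_1\cdots p_r$, $P_\infty$ the pole of $x$ in $F$. Assumptions: (P1) $P_\infty$ is totally ramified in $E/F$. (P2) There is a tower $E=E_0\supsetneq E_1\supsetneq\cdots\supsetneq E_r=F$ with $E_i/E_{i+1}$ Galois of degree $p_{i+1}$. (P3) $E_i=E_{i+1}(y_i)$; with $P^{(i)}_\infty$ the unique place of $E_i$ over $P_\infty$, $y_i$ has $P^{(i)}_\infty$ as only pole, $\gcd(\nu_{P^{(i)}_\infty}(y_i),p_{i+1})=1$, and $\{1,y_i,\dots,y_i^{p_{i+1}-1}\}$ is an integral basis of $E_i/E_{i+1}$ at every place $Q\ne P^{(i+1)}_\infty$ of $E_{i+1}$. (P4) There are $n$ rational places $P_1,\dots,P_n$ of $F$ (different from $P_\infty$) that split completely in $E/F$. For $u=u_0+u_1p_1+\cdots+u_{r-1}p_1\cdots p_{r-1}\in[0,m-1]$ ($0\le u_i<p_{i+1}$) put $\mathbf y^u=y_0^{u_0}\cdots y_{r-1}^{u_{r-1}}$. Every $f\in\mathcal L(\lambda P^{(0)}_\infty)$ has a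 unique representation $f=\sum_{u=0}^{m-1}f_u(x)\mathbf y^u$ with $f_u\in\mathbb{F}_q[x]$, $\deg f_u<k$. For each $j$ let $\mathcal P[j]=\{\mathfrak P_{1,j},\dots,\mathfrak P_{m,j}\}$ be the $m$ rational places of $E$ over $P_j$ (in a fixed order), $\mathcal P=\bigcup_j\mathcal P[j]$, $N=nm$, $\mathrm{ev}_{\mathcal P}(f)=(f(\mathfrak P_{1,1}),\dots,f(\mathfrak P_{m,1}),\dots,f(\mathfrak P_{1,n}),\dots,f(\mathfrak P_{m,n}))$. The AG code is $\mathfrak C(\lambda P^{(0)}_\infty,\mathcal P)=\{\mathrm{ev}_{\mathcal P}(f): f\in\mathcal L(\lambda P^{(0)}_\infty)\}$, and the AG-based interleaved RS code $\mathrm{IRS}_m(\lambda P^{(0)}_\infty,\mathcal P)$ is the set of $m\times n$ matrices $\mathsf C_f=(f_{i-1}(P_j))_{1\le i\le m,1\le j\le n}$ for $f=\sum_u f_u(x)\mathbf y^u\in\mathcal L(\lambda P^{(0)}_\infty)$. *)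

theory Defs
  imports "HOL-Computational_Algebra.Polynomial"
begin

text \<open>Algebraic function fields E/K are modelled inside a field type 'e:
  the whole type is the function field E, subfields are sets of elements,
  and the constant field K = F_q is a finite subfield.  Places of a subfield L
  are represented (as usual) by their valuation rings V with K \<subseteq> V \<subset> L.\<close>

definition subfield :: "'a::field set \<Rightarrow> bool" where
  "subfield S \<longleftrightarrow> 0 \<in> S \<and> 1 \<in> S \<and> (\<forall>a\<in>S. \<forall>b\<in>S. a + b \<in> S \<and> a * b \<in> S)
      \<and> (\<forall>a\<in>S. - a \<in> S \<and> inverse a \<in> S)"

definition algebraic_over :: "'a::field set \<Rightarrow> 'a \<Rightarrow> bool" where
  "algebraic_over K z \<longleftrightarrow> (\<exists>q. q \<noteq> 0 \<and> set (coeffs q) \<subseteq> K \<and> poly q z = 0)"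

definition full_constant_field :: "'a::field set \<Rightarrow> bool" where
  "full_constant_field K \<longleftrightarrow> (\<forall>z. algebraic_over K z \<longrightarrow> z \<in> K)"

definition rat_fun_field :: "'a::field set \<Rightarrow> 'a \<Rightarrow> 'a set" where
  "rat_fun_field K x = {poly a x / poly b x | a b. set (coeffs a) \<subseteq> K \<and> set (coeffs b) \<subseteq> K
      \<and> poly b x \<noteq> 0}"

definition adjoin :: "'a::field set \<Rightarrow> 'a \<Rightarrow> 'a set" where
  "adjoin M y = \<Inter>{S. subfield S \<and> M \<subseteq> S \<and> y \<in> S}"

definition ext_degree_is :: "'a::field set \<Rightarrow> 'a set \<Rightarrow> nat \<Rightarrow> bool" where
  "ext_degree_is M L n \<longleftrightarrow> subfield M \<and> subfield L \<and> M \<subseteq> L \<and>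
     (\<exists>b. (\<forall>i<n. b i \<in> L) \<and>
          (\<forall>c. (\<forall>i<n. c i \<in> M) \<and> (\<Sum>i<n. c i * b i) = 0 \<longrightarrow> (\<forall>i<n. c i = 0)) \<and>
          (\<forall>z\<in>L. \<exists>c. (\<forall>i<n. c i \<in> M) \<and> z = (\<Sum>i<n. c i * b i)))"

definition rel_automorphisms :: "'a::field set \<Rightarrow> 'a set \<Rightarrow> ('a \<Rightarrow> 'a) set" where
  "rel_automorphisms M L = {\<sigma>. bij_betw \<sigma> L L \<and>
      (\<forall>a\<in>L. \<forall>b\<in>L. \<sigma> (a + b) = \<sigma> a + \<sigma> b \<and> \<sigma> (a * b) = \<sigma> a * \<sigma> b) \<and>
      (\<forall>a\<in>M. \<sigma> a = a) \<and> (\<forall>a. a \<notin> L \<longrightarrow> \<sigma> a = a)}"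

definition galois_of_degree :: "'a::field set \<Rightarrow> 'a set \<Rightarrow> nat \<Rightarrow> bool" where
  "galois_of_degree M L n \<longleftrightarrow> ext_degree_is M L n \<and> card (rel_automorphisms M L) = n"

definition place :: "'a::field set \<Rightarrow> 'a set \<Rightarrow> 'a set \<Rightarrow> bool" where
  "place K L V \<longleftrightarrow> V \<subseteq> L \<and> K \<subseteq> V \<and> V \<noteq> L \<and>
     (\<forall>a\<in>V. \<forall>b\<in>V. a + b \<in> V \<and> a * b \<in> V \<and> - a \<in> V) \<and>
     (\<forall>z\<in>L. z \<noteq> 0 \<longrightarrow> z \<in> V \<or> inverse z \<in> V)"

definition max_ideal :: "'a::field set \<Rightarrow> 'a set" where
  "max_ideal V = {z\<in>V. z = 0 \<or> inverse z \<notin> V}"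

definition unit_set :: "'a::field set \<Rightarrow> 'a set" where
  "unit_set V = {z\<in>V. z \<noteq> 0 \<and> inverse z \<in> V}"

definition uniformizer :: "'a::field set \<Rightarrow> 'a \<Rightarrow> bool" where
  "uniformizer V t \<longleftrightarrow> t \<in> max_ideal V \<and> max_ideal V = {t * a | a. a \<in> V}"

text \<open>Normalized discrete valuation \<nu>_O(z) (z \<noteq> 0): z = t^n * unit.\<close>
definition val :: "'a::field set \<Rightarrow> 'a \<Rightarrow> int" where
  "val V z = (THE n::int. \<exists>t. uniformizer V t \<and>
      (if n \<ge> 0 then z / t ^ nat n \<in> unit_set V else z * t ^ nat (- n) \<in> unit_set V))"

definition ram_index :: "'a::field set \<Rightarrow> 'a set \<Rightarrow> int" where
  "ram_index Q P = val Q (SOME t. uniformizer P t)"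

definition rational_place :: "'a::field set \<Rightarrow> 'a set \<Rightarrow> bool" where
  "rational_place K V \<longleftrightarrow> (\<forall>z\<in>V. \<exists>c\<in>K. z - c \<in> max_ideal V)"

definition eval_at :: "'a::field set \<Rightarrow> 'a set \<Rightarrow> 'a \<Rightarrow> 'a" where
  "eval_at K V z = (THE c. c \<in> K \<and> z - c \<in> max_ideal V)"

definition pole_place :: "'a::field set \<Rightarrow> 'a set \<Rightarrow> 'a \<Rightarrow> 'a set" where
  "pole_place K F x = (THE V. place K F V \<and> x \<notin> V)"

definition place_above :: "'a::field set \<Rightarrow> 'a set \<Rightarrow> 'a set \<Rightarrow> 'a set \<Rightarrow> 'a set" where
  "place_above K L P F = (THE V. place K L V \<and> V \<inter> F = P)"

definition totally_ramified :: "'a::field set \<Rightarrow> 'a set \<Rightarrow> 'a set \<Rightarrow> 'a set \<Rightarrow> nat \<Rightarrow> bool" where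
  "totally_ramified K F L P d \<longleftrightarrow> (\<exists>Q. place K L Q \<and> Q \<inter> F = P) \<and>
     (\<forall>Q. place K L Q \<and> Q \<inter> F = P \<longrightarrow> ram_index Q P = int d)"

definition int_closure :: "'a::field set \<Rightarrow> 'a set \<Rightarrow> 'a set \<Rightarrow> 'a set \<Rightarrow> 'a set" where
  "int_closure K L M Q = {z\<in>L. \<forall>V. place K L V \<and> V \<inter> M = Q \<longrightarrow> z \<in> V}"

definition RR_space :: "'a::field set \<Rightarrow> nat \<Rightarrow> 'a set \<Rightarrow> 'a set" where
  "RR_space K lam P = {f. f = 0 \<or> ((\<forall>V. place K UNIV V \<and> V \<noteq> P \<longrightarrow> f \<in> V) \<and> - int lam \<le> val P f)}"

definition digit :: "(nat \<Rightarrow> nat) \<Rightarrow> nat \<Rightarrow> nat \<Rightarrow> nat" where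
  "digit p u i = (u div (\<Prod>l<i. p l)) mod p i"

definition ymon :: "(nat \<Rightarrow> nat) \<Rightarrow> nat \<Rightarrow> (nat \<Rightarrow> 'a::field) \<Rightarrow> nat \<Rightarrow> 'a" where
  "ymon p r y u = (\<Prod>i<r. y i ^ digit p u i)"

definition coeff_rep :: "'a::field set \<Rightarrow> 'a \<Rightarrow> (nat \<Rightarrow> nat) \<Rightarrow> nat \<Rightarrow> (nat \<Rightarrow> 'a)
    \<Rightarrow> nat \<Rightarrow> nat \<Rightarrow> 'a \<Rightarrow> 'a poly list" where
  "coeff_rep K x p r y m k f = (THE fs. length fs = m \<and>
      (\<forall>g\<in>set fs. set (coeffs g) \<subseteq> K \<and> degree g < k) \<and>
      f = (\<Sum>u<m. poly (fs ! u) x * ymon p r y u))"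

definition ev_code :: "'a::field set \<Rightarrow> (nat \<Rightarrow> nat \<Rightarrow> 'a set) \<Rightarrow> nat \<Rightarrow> nat \<Rightarrow> 'a \<Rightarrow> 'a list" where
  "ev_code K Pl m n f = concat (map (\<lambda>j. map (\<lambda>i. eval_at K (Pl i j) f) [0..<m]) [0..<n])"

definition irs_matrix :: "'a::field set \<Rightarrow> 'a \<Rightarrow> (nat \<Rightarrow> nat) \<Rightarrow> nat \<Rightarrow> (nat \<Rightarrow> 'a)
    \<Rightarrow> nat \<Rightarrow> nat \<Rightarrow> (nat \<Rightarrow> 'a set) \<Rightarrow> nat \<Rightarrow> 'a \<Rightarrow> 'a list list" where
  "irs_matrix K x p r y m k P n f =
     (let fs = coeff_rep K x p r y m k f in
      map (\<lambda>u. map (\<lambda>j. poly (fs ! u) (eval_at K (P j) x)) [0..<n]) [0..<m])"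

end

theory Submission
  imports Defs
begin

text \<open>
  At a place \<open>P\<^sub>j\<close> the evaluation \<open>f(Q\<^sub>i\<^sub>j) = (\<Sum>u. f\<^sub>u(P\<^sub>j) * y\<^sup>u(Q\<^sub>i\<^sub>j))\<close> is obtained from the
  column \<open>(f\<^sub>u(P\<^sub>j))\<^sub>u\<close> by the square matrix \<open>(y\<^sup>u(Q\<^sub>i\<^sub>j))\<close> over \<open>K\<close>. This matrix is invertible: by the
  Chinese remainder theorem some element integral over \<open>P\<^sub>j\<close> is 1 at one prescribed place above \<open>P\<^sub>j\<close> and
  0 at the others, and the monomials \<open>y\<^sup>u\<close> are an integral basis at \<open>P\<^sub>j\<close>. Hence \<open>ev(f)\<close> and
  \<open>C\<^sub>f\<close> determine each other.

  The expansion of \<open>f\<close> itself is found one step of the tower at a time. Total ramification forces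
  every step to have ramification index equal to its degree, so the place at infinity is unique in
  every \<open>E\<^sub>i\<close>, and the terms \<open>a\<^sub>j * y\<^sub>i ^ j\<close> have pairwise different values there. This gives
  uniqueness of the coefficients and bounds their pole orders; the integral bases make the coefficients
  regular at all other places, and an element of \<open>K(x)\<close> regular outside infinity is a polynomial.
\<close>

section \<open>Valuation rings of function fields\<close>

text \<open>Places are bare valuation rings here, and \<open>val\<close> is a definite description
  that carries no information until a uniformizer is known, so discreteness has to be proved. This
  happens only at infinity: \<open>inverse x\<close> is a uniformizer of the bottom field, and a
  linear dependence among more elements than the degree carries discreteness one step up, while
  bounding the ramification index by the degree. At the places \<open>P j\<close> valuations never
  enter, only maximal ideals and residues. A second obstacle is that integral bases are given one
  place at a time, with coefficients that might depend on the place; independence over the lower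
  field makes them the same for all places. Both codes are images of one space of functions. The
  claim on \<tau> thus reduces to the equality of two equivalence relations on that space, and no
  dimension has to be counted.\<close>

lemma subfield_sum: "subfield S \<Longrightarrow> (\<And>i. i \<in> I \<Longrightarrow> f i \<in> S) \<Longrightarrow> sum f I \<in> S"
  by (induction I rule: infinite_finite_induct) (auto simp: subfield_def)

lemma subfield_power: "subfield S \<Longrightarrow> a \<in> S \<Longrightarrow> a ^ n \<in> S"
  by (induction n) (auto simp: subfield_def)

lemma subfield_power_int: "subfield S \<Longrightarrow> a \<in> S \<Longrightarrow> a powi n \<in> S"
  by (auto simp: power_int_def subfield_power) (auto simp: subfield_def subfield_power)

lemma subfield_closed:
  assumes "subfield S"
  shows "0 \<in> S" "1 \<in> S" "a \<in> S \<Longrightarrow> b \<in> S \<Longrightarrow> a + b \<in> S" "a \<in> S \<Longrightarrow> b \<in> S \<Longrightarrow> a * b \<in> S"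
    "a \<in> S \<Longrightarrow> - a \<in> S" "a \<in> S \<Longrightarrow> inverse a \<in> S"
    "a \<in> S \<Longrightarrow> b \<in> S \<Longrightarrow> a - b \<in> S" "a \<in> S \<Longrightarrow> b \<in> S \<Longrightarrow> a / b \<in> S"
proof -
  show "a \<in> S \<Longrightarrow> b \<in> S \<Longrightarrow> a - b \<in> S"
    using assms unfolding subfield_def by (metis add_uminus_conv_diff)
  show "a \<in> S \<Longrightarrow> b \<in> S \<Longrightarrow> a / b \<in> S"
    using assms unfolding subfield_def by (simp add: divide_inverse)
qed (use assms in \<open>auto simp: subfield_def\<close>)

text \<open>Gaussian elimination: an equation \<open>l\<close> is removed together with one unknown
  \<open>k\<close> occurring in it, so the surplus of unknowns survives. All divisions take place
  inside \<open>M\<close>, which is a set and not a type.\<close>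

lemma linear_dependence:
  fixes A :: "'i \<Rightarrow> 'j \<Rightarrow> 'a::field"
  assumes M: "subfield M" and "finite J" "finite I" "card J < card I"
    and "\<And>i j. i \<in> I \<Longrightarrow> j \<in> J \<Longrightarrow> A i j \<in> M"
  shows "\<exists>c. (\<forall>i. c i \<in> M) \<and> (\<exists>i\<in>I. c i \<noteq> 0) \<and> (\<forall>j\<in>J. (\<Sum>i\<in>I. c i * A i j) = 0)"
  using assms(2-)
proof (induction J arbitrary: I A rule: finite_induct)
  case empty
  then obtain i where "i \<in> I" by fastforce
  with M show ?case
    by (intro exI[of _ "\<lambda>_. 1"]) (auto simp: subfield_closed)
next
  case (insert l J)
  note cl = subfield_closed[OF M]
  show ?case
  proof (cases "\<forall>i\<in>I. A i l = 0")
    case True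
    have "card J < card I" using insert by simp
    from insert.IH[OF insert.prems(1) this, of A] insert.prems(3) True show ?thesis by auto
  next
    case False
    then obtain k where k: "k \<in> I" "A k l \<noteq> 0" by blast
    define B where "B i j = A i j - A i l / A k l * A k j" for i j
    have "card J < card (I - {k})" using insert k by simp
    moreover have "B i j \<in> M" if "i \<in> I - {k}" "j \<in> J" for i j
      unfolding B_def using that k insert.prems(3) by (intro cl(7) cl(4) cl(8)) auto
    ultimately obtain c where c: "\<forall>i. c i \<in> M" "\<exists>i\<in>I-{k}. c i \<noteq> 0"
        "\<forall>j\<in>J. (\<Sum>i\<in>I-{k}. c i * B i j) = 0"
      using insert.IH[of "I - {k}" B] insert.prems(1) by blast
    \<comment> \<open>The value of the unknown \<open>k\<close> forced by equation \<open>l\<close>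
      once the other unknowns are fixed.\<close>
    define d where "d = - (\<Sum>i\<in>I-{k}. c i * A i l) / A k l"
    define c' where "c' = c(k := d)"
    have dM: "d \<in> M" unfolding d_def using c(1) k insert.prems(3)
      by (intro cl(8) cl(5) subfield_sum[OF M] cl(4)) auto
    have split: "(\<Sum>i\<in>I. c' i * A i j) = d * A k j + (\<Sum>i\<in>I-{k}. c i * A i j)" for j
      using k insert.prems(1) by (simp add: sum.remove[of I k] c'_def)
    have "(\<Sum>i\<in>I. c' i * A i j) = 0" if "j \<in> insert l J" for j
    proof (cases "j = l")
      case True
      then show ?thesis unfolding split d_def using k by simp
    next
      case False
      with that c(3) have "(\<Sum>i\<in>I-{k}. c i * B i j) = 0" by auto
      then have "(\<Sum>i\<in>I-{k}. c i * A i j) = (\<Sum>i\<in>I-{k}. c i * A i l) / A k l * A k j"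
        unfolding B_def by (simp add: algebra_simps sum_subtractf sum_distrib_left sum_distrib_right sum_divide_distrib)
      then show ?thesis unfolding split d_def by simp
    qed
    moreover have "\<forall>i. c' i \<in> M" using c(1) dM by (simp add: c'_def)
    moreover have "\<exists>i\<in>I. c' i \<noteq> 0" using c(2) by (auto simp: c'_def)
    ultimately show ?thesis by blast
  qed
qed

text \<open>Coordinates in a spanning family of \<open>d\<close> elements turn the relation into
  \<open>d\<close> equations in more than \<open>d\<close> unknowns. The elements are indexed, so
  that coinciding powers of one element still count separately.\<close>

lemma ext_degree_dependence:
  assumes deg: "ext_degree_is M L d" and I: "finite I" "d < card I" "\<And>i. i \<in> I \<Longrightarrow> z i \<in> L"
  shows "\<exists>c. (\<forall>i. c i \<in> M) \<and> (\<exists>i\<in>I. c i \<noteq> 0) \<and> (\<Sum>i\<in>I. c i * z i) = 0"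
proof -
  obtain b where b: "\<forall>z\<in>L. \<exists>c. (\<forall>i<d. c i \<in> M) \<and> z = (\<Sum>i<d. c i * b i)"
    and M: "subfield M" using deg unfolding ext_degree_is_def by blast
  have "\<forall>i\<in>I. \<exists>c. (\<forall>j<d. c j \<in> M) \<and> z i = (\<Sum>j<d. c j * b j)" using b I(3) by blast
  then obtain A where A: "\<And>i j. i \<in> I \<Longrightarrow> j < d \<Longrightarrow> A i j \<in> M"
    "\<And>i. i \<in> I \<Longrightarrow> z i = (\<Sum>j<d. A i j * b j)" by metis
  obtain c where c: "\<forall>i. c i \<in> M" "\<exists>i\<in>I. c i \<noteq> 0" "\<forall>j\<in>{..<d}. (\<Sum>i\<in>I. c i * A i j) = 0"
    using linear_dependence[OF M, of "{..<d}" I A] I A by auto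
  have "(\<Sum>i\<in>I. c i * z i) = (\<Sum>i\<in>I. \<Sum>j<d. c i * A i j * b j)"
    using A(2) by (simp add: sum_distrib_left mult.assoc)
  also have "\<dots> = (\<Sum>j<d. (\<Sum>i\<in>I. c i * A i j) * b j)"
    by (subst sum.swap) (simp add: sum_distrib_right)
  also have "\<dots> = 0" using c(3) by simp
  finally show ?thesis using c by blast
qed

section \<open>Units, maximal ideal and dominant terms in a valuation ring\<close>

locale valued_subfield =
  fixes K L V :: "'a::field set"
  assumes K: "subfield K" and L: "subfield L" and pl: "place K L V"
begin

lemma in_L: "z \<in> V \<Longrightarrow> z \<in> L" and K_in: "c \<in> K \<Longrightarrow> c \<in> V"
  using pl by (auto simp: place_def)

lemma V_closed: "0 \<in> V" "1 \<in> V" "a \<in> V \<Longrightarrow> b \<in> V \<Longrightarrow> a + b \<in> V"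
  "a \<in> V \<Longrightarrow> b \<in> V \<Longrightarrow> a * b \<in> V" "a \<in> V \<Longrightarrow> - a \<in> V" "a \<in> V \<Longrightarrow> b \<in> V \<Longrightarrow> a - b \<in> V"
proof -
  show "a \<in> V \<Longrightarrow> b \<in> V \<Longrightarrow> a - b \<in> V"
    using pl unfolding place_def by (metis add_uminus_conv_diff)
qed (use pl K in \<open>auto simp: place_def subfield_def\<close>)

lemma V_sum: "(\<And>i. i \<in> I \<Longrightarrow> f i \<in> V) \<Longrightarrow> sum f I \<in> V"
  by (induction I rule: infinite_finite_induct) (auto simp: V_closed)

lemma V_prod: "(\<And>i. i \<in> I \<Longrightarrow> f i \<in> V) \<Longrightarrow> prod f I \<in> V"
  by (induction I rule: infinite_finite_induct) (auto simp: V_closed)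

lemma V_power: "a \<in> V \<Longrightarrow> a ^ n \<in> V"
  by (induction n) (auto simp: V_closed)

lemma in_V_or_inverse: "z \<in> L \<Longrightarrow> z \<noteq> 0 \<Longrightarrow> z \<in> V \<or> inverse z \<in> V"
  using pl by (auto simp: place_def)

lemma unit_setD: "u \<in> unit_set V \<Longrightarrow> u \<in> V" "u \<in> unit_set V \<Longrightarrow> u \<noteq> 0"
  "u \<in> unit_set V \<Longrightarrow> inverse u \<in> V" "u \<in> unit_set V \<Longrightarrow> u \<in> L"
  "u \<in> unit_set V \<Longrightarrow> u \<notin> max_ideal V"
  by (auto simp: unit_set_def max_ideal_def in_L)

lemma unit_or_max: "z \<in> V \<Longrightarrow> z \<notin> max_ideal V \<Longrightarrow> z \<in> unit_set V"
  by (auto simp: unit_set_def max_ideal_def)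

lemma max_idealD: "z \<in> max_ideal V \<Longrightarrow> z \<in> V" "z \<in> max_ideal V \<Longrightarrow> z \<in> L"
  by (auto simp: max_ideal_def in_L)

lemma unit_closed: "1 \<in> unit_set V" "u \<in> unit_set V \<Longrightarrow> v \<in> unit_set V \<Longrightarrow> u * v \<in> unit_set V"
  "u \<in> unit_set V \<Longrightarrow> inverse u \<in> unit_set V"
  "u \<in> unit_set V \<Longrightarrow> v \<in> unit_set V \<Longrightarrow> u / v \<in> unit_set V"
  by (auto simp: unit_set_def V_closed divide_inverse)

lemma unit_power: "u \<in> unit_set V \<Longrightarrow> u ^ n \<in> unit_set V"
  by (induction n) (auto simp: unit_closed)

lemma unit_power_int: "u \<in> unit_set V \<Longrightarrow> u powi n \<in> unit_set V"
  by (auto simp: power_int_def unit_power) (metis unit_closed(3) power_inverse unit_power)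

lemma K_unit: "c \<in> K \<Longrightarrow> c \<noteq> 0 \<Longrightarrow> c \<in> unit_set V"
  using K K_in by (auto simp: unit_set_def subfield_def)

lemma not_in_V: "z \<in> L \<Longrightarrow> z \<notin> V \<Longrightarrow> inverse z \<in> max_ideal V"
  using in_V_or_inverse[of z] V_closed(1) by (auto simp: max_ideal_def)

lemma inverse_max_ideal: "z \<in> max_ideal V \<Longrightarrow> z \<noteq> 0 \<Longrightarrow> inverse z \<notin> V"
  by (auto simp: max_ideal_def)

lemma max_mult: "a \<in> max_ideal V \<Longrightarrow> b \<in> V \<Longrightarrow> a * b \<in> max_ideal V"
proof -
  assume a: "a \<in> max_ideal V" and b: "b \<in> V"
  then have ab: "a * b \<in> V" using V_closed by (auto simp: max_ideal_def)
  { assume "a * b \<noteq> 0" "inverse (a * b) \<in> V"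
    then have "b * inverse (a * b) \<in> V" using b V_closed by blast
    moreover have "b * inverse (a * b) = inverse a" using \<open>a * b \<noteq> 0\<close> by simp
    ultimately have "inverse a \<in> V" by metis
    with a \<open>a * b \<noteq> 0\<close> have False by (auto simp: max_ideal_def) }
  with ab show ?thesis by (auto simp: max_ideal_def)
qed

lemma max_mult': "b \<in> V \<Longrightarrow> a \<in> max_ideal V \<Longrightarrow> b * a \<in> max_ideal V"
  using max_mult[of a b] by (simp add: mult.commute)

lemma max_zero: "0 \<in> max_ideal V"
  by (auto simp: max_ideal_def V_closed)

text \<open>Of two nonzero elements one divides the other in \<open>V\<close>, so the sum is a
  multiple of one of them.\<close>

lemma max_add: "a \<in> max_ideal V \<Longrightarrow> b \<in> max_ideal V \<Longrightarrow> a + b \<in> max_ideal V"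
proof -
  have *: "a + b \<in> max_ideal V" if a: "a \<in> max_ideal V" and b: "b \<in> max_ideal V"
      and nz: "b \<noteq> 0" and ab: "a / b \<in> V" for a b
  proof -
    have "(1 + a / b) * b = a + b" using nz by (simp add: field_simps)
    then show ?thesis using max_mult'[OF V_closed(3)[OF V_closed(2) ab] b] by simp
  qed
  assume a: "a \<in> max_ideal V" and b: "b \<in> max_ideal V"
  show ?thesis
  proof (cases "a = 0 \<or> b = 0")
    case False
    have "a / b \<in> V \<or> b / a \<in> V"
      using in_V_or_inverse[of "a / b"] a b False subfield_closed(8)[OF L] by (auto simp: max_idealD)
    then show ?thesis using * a b False by (metis add.commute)
  qed (use a b in auto)
qed

lemma max_minus: "a \<in> max_ideal V \<Longrightarrow> - a \<in> max_ideal V"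
  using max_mult[of a "-1"] V_closed by simp

lemma max_diff: "a \<in> max_ideal V \<Longrightarrow> b \<in> max_ideal V \<Longrightarrow> a - b \<in> max_ideal V"
  using max_add[of a "-b"] max_minus by simp

lemma max_sum: "(\<And>i. i \<in> I \<Longrightarrow> f i \<in> max_ideal V) \<Longrightarrow> sum f I \<in> max_ideal V"
  by (induction I rule: infinite_finite_induct) (auto simp: max_add max_zero)

lemma one_not_max: "1 \<notin> max_ideal V"
  by (auto simp: max_ideal_def V_closed)

lemma max_power: "a \<in> max_ideal V \<Longrightarrow> n > 0 \<Longrightarrow> a ^ n \<in> max_ideal V"
  by (cases n) (auto intro!: max_mult V_power simp: max_idealD)

lemma unit_add_max: "u \<in> unit_set V \<Longrightarrow> a \<in> max_ideal V \<Longrightarrow> u + a \<in> unit_set V"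
proof -
  assume u: "u \<in> unit_set V" and a: "a \<in> max_ideal V"
  have "u + a \<notin> max_ideal V"
    using max_diff[of "u + a" a] a unit_setD(5)[OF u] by auto
  then show ?thesis using V_closed(3)[OF unit_setD(1)[OF u] max_idealD(1)[OF a]] unit_or_max by blast
qed

text \<open>Terms with pairwise different values: the one of least value determines the value of the sum.\<close>
lemma dominant_term:
  assumes "finite I" "I \<noteq> {}"
    and "\<And>i. i \<in> I \<Longrightarrow> z i \<in> L" "\<And>i. i \<in> I \<Longrightarrow> z i \<noteq> 0"
    and "\<And>i j. i \<in> I \<Longrightarrow> j \<in> I \<Longrightarrow> i \<noteq> j \<Longrightarrow> z i / z j \<notin> unit_set V"
  shows "\<exists>k\<in>I. sum z I / z k \<in> unit_set V \<and> (\<forall>i\<in>I - {k}. z i / z k \<in> max_ideal V)"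
  using assms
proof (induction I rule: finite_ne_induct)
  case (singleton i)
  then show ?case by (auto simp: unit_closed)
next
  case (insert l I)
  then obtain k where k: "k \<in> I" "sum z I / z k \<in> unit_set V"
    "\<And>i. i \<in> I - {k} \<Longrightarrow> z i / z k \<in> max_ideal V" by (metis insert_iff)
  have nz: "z l \<noteq> 0" "z k \<noteq> 0" and L': "z l / z k \<in> L"
    and nu: "z l / z k \<notin> unit_set V" "z k / z l \<notin> unit_set V"
    using insert k(1) subfield_closed(8)[OF L] by auto
  show ?case
  proof (cases "z l / z k \<in> V")
    case True
    then have m: "z l / z k \<in> max_ideal V" using nu unit_or_max by blast
    have "sum z (insert l I) / z k = sum z I / z k + z l / z k"
      using insert by (simp add: add_divide_distrib)
    then have "sum z (insert l I) / z k \<in> unit_set V" using unit_add_max[OF k(2) m] by simp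
    then show ?thesis using k m by (intro bexI[of _ k]) auto
  next
    case False
    \<comment> \<open>The new term has the smaller value and takes over the role of
      \<open>k\<close>; the old terms are compared with it through \<open>z k\<close>.\<close>
    then have m: "z k / z l \<in> max_ideal V" using not_in_V[OF L'] by simp
    have mI: "z i / z l \<in> max_ideal V" if "i \<in> I" for i
    proof (cases "i = k")
      case False
      then have "z i / z k * (z k / z l) \<in> max_ideal V"
        using max_mult[OF k(3) max_idealD(1)[OF m]] that by simp
      then show ?thesis using nz by simp
    qed (use m in auto)
    have "sum z (insert l I) / z l = 1 + (\<Sum>i\<in>I. z i / z l)"
      using insert nz by (simp add: add_divide_distrib sum_divide_distrib)
    then have "sum z (insert l I) / z l \<in> unit_set V"
      using unit_add_max[OF unit_closed(1) max_sum] mI by metis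
    then show ?thesis using mI by (intro bexI[of _ l]) auto
  qed
qed

text \<open>Valuation rings are integrally closed: if \<open>z\<close> had a pole, dividing the
  equation by \<open>z ^ d\<close> would write 1 as a sum of elements of the maximal ideal.\<close>

lemma integral_in_V:
  assumes z: "z \<in> L" and a: "\<And>j. j < d \<Longrightarrow> a j \<in> V" and eq: "z ^ d = (\<Sum>j<d. a j * z ^ j)"
  shows "z \<in> V"
proof (rule ccontr)
  assume nz: "z \<notin> V"
  then have m: "inverse z \<in> max_ideal V" and z0: "z \<noteq> 0" using not_in_V z V_closed by auto
  have "1 = z ^ d * inverse z ^ d" using z0 by (simp add: power_inverse)
  also have "\<dots> = (\<Sum>j<d. a j * inverse z ^ (d - j))"
    unfolding eq sum_distrib_right
    by (intro sum.cong refl) (use z0 in \<open>simp add: power_diff field_simps power_inverse\<close>)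
  also have "\<dots> \<in> max_ideal V"
    using a m by (intro max_sum max_mult' max_power) auto
  finally show False using one_not_max by simp
qed

text \<open>Properness is the only property of a place that can be lost by intersecting with a
  smaller field containing \<open>K\<close>.\<close>

lemma restrict:
  assumes M: "subfield M" "K \<subseteq> M" "M \<subseteq> L" and ne: "V \<inter> M \<noteq> M"
  shows "valued_subfield K M (V \<inter> M)"
proof
  show "place K M (V \<inter> M)"
    using pl ne M unfolding place_def by (auto simp: subfield_closed[OF M(1)])
qed (use K M in auto)

end

lemma max_ideal_Int: "subfield M \<Longrightarrow> max_ideal (V \<inter> M) = max_ideal V \<inter> M"
  by (auto simp: max_ideal_def subfield_def)

lemma unit_set_Int: "subfield M \<Longrightarrow> unit_set (V \<inter> M) = unit_set V \<inter> M"
  by (auto simp: unit_set_def subfield_def)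

section \<open>Discrete places and their extensions\<close>

text \<open>Discreteness is given by a witness \<open>s\<close>, so that values can be computed from
  one fixed element, although \<open>val\<close> itself ranges over all uniformizers.\<close>

locale discrete_place = valued_subfield +
  fixes s
  assumes s_max: "s \<in> max_ideal V" and s_nz: "s \<noteq> 0"
    and unit_part: "z \<in> L \<Longrightarrow> z \<noteq> 0 \<Longrightarrow> \<exists>n::int. z / s powi n \<in> unit_set V"
begin

lemma s_powi_max: "n > 0 \<Longrightarrow> s powi n \<in> max_ideal V"
  using max_power[OF s_max, of "nat n"] by (simp add: power_int_def)

lemma s_powi_V: "s powi n \<in> V \<longleftrightarrow> n \<ge> 0"
proof
  assume "n \<ge> 0"
  then show "s powi n \<in> V" using V_power[OF max_idealD(1)[OF s_max]] by (simp add: power_int_def)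
next
  assume "s powi n \<in> V"
  then show "n \<ge> 0" using inverse_max_ideal[OF s_powi_max[of "-n"]] s_nz
    by (cases "n < 0") (auto simp: power_int_minus)
qed

lemma s_powi_unit: "s powi n \<in> unit_set V \<longleftrightarrow> n = 0"
  using s_powi_V[of n] s_powi_V[of "-n"] s_nz unit_closed(1)
  by (auto simp: unit_set_def power_int_minus)

lemma uniformizer_s: "uniformizer V s"
  unfolding uniformizer_def
proof (intro conjI s_max set_eqI iffI)
  fix z assume z: "z \<in> max_ideal V"
  have "z / s \<in> V"
  proof (cases "z = 0")
    case False
    obtain n where n: "z / s powi n \<in> unit_set V" using unit_part[OF max_idealD(2)[OF z] False] by blast
    have "n > 0"
    proof (rule ccontr)
      assume "\<not> n > 0"
      then have "s powi (-n) \<in> V" by (simp add: s_powi_V)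
      then have "z * s powi (-n) \<in> max_ideal V" using max_mult z by blast
      then show False using n unit_setD(5) by (simp add: power_int_minus divide_inverse)
    qed
    then have "z / s powi n * s powi (n - 1) \<in> V"
      using n by (intro V_closed(4)) (auto simp: s_powi_V unit_setD)
    also have "z / s powi n * s powi (n - 1) = z / s"
      using s_nz by (simp add: power_int_diff)
    finally show ?thesis .
  qed (simp add: V_closed)
  then show "z \<in> {s * a |a. a \<in> V}" using s_nz by (auto intro!: exI[of _ "z / s"])
qed (auto intro: max_mult[OF s_max])

lemma uniformizer_quotient:
  assumes "uniformizer V t" shows "t / s \<in> unit_set V"
proof -
  have t: "t \<in> max_ideal V" "max_ideal V = {t * a |a. a \<in> V}"
    using assms by (auto simp: uniformizer_def)
  obtain a where a: "a \<in> V" "s = t * a" using s_max t(2) by blast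
  obtain b where b: "b \<in> V" "t = s * b" using uniformizer_s t(1) by (auto simp: uniformizer_def)
  have ba: "b * a = 1" using a(2) b(2) s_nz by auto
  then show ?thesis using a b s_nz inverse_unique[OF ba] by (auto simp: unit_set_def)
qed

text \<open>The description behind \<open>val\<close> lets the uniformizer vary, so the exponent
  must be the same for all of them. It is, because any two uniformizers differ by a unit.\<close>

lemma val_eqI:
  assumes "z / s powi n \<in> unit_set V" shows "val V z = n"
proof -
  have unif: "uniformizer V t \<Longrightarrow> z / t powi i \<in> unit_set V \<longleftrightarrow> i = n" for t i
  proof -
    assume "uniformizer V t"
    then have u: "t / s \<in> unit_set V" by (rule uniformizer_quotient)
    then have u': "(t / s) powi i \<in> unit_set V" by (rule unit_power_int)
    have t: "t \<noteq> 0" using u unit_setD(2) by fastforce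
    have eq: "s powi (n - i) = (z / t powi i) / (z / s powi n) * (t / s) powi i"
      using assms unit_setD(2)[OF assms] s_nz t
      by (simp add: power_int_diff power_int_divide_distrib field_simps)
    have eq': "z / t powi i = s powi (n - i) * (z / s powi n) / (t / s) powi i"
      using assms unit_setD(2)[OF assms] s_nz t
      by (simp add: power_int_diff power_int_divide_distrib field_simps)
    show ?thesis
    proof
      assume "z / t powi i \<in> unit_set V"
      then have "s powi (n - i) \<in> unit_set V" unfolding eq using assms u' by (intro unit_closed(2) unit_closed(4)[of "z / t powi i"])
      then show "i = n" by (simp add: s_powi_unit)
    next
      assume "i = n"
      then have "s powi (n - i) \<in> unit_set V" by (simp add: unit_closed)
      then show "z / t powi i \<in> unit_set V" unfolding eq' using assms u' by (intro unit_closed(4)[of "s powi (n - i) * (z / s powi n)"] unit_closed(2))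
    qed
  qed
  have powi: "(if i \<ge> 0 then z / t ^ nat i \<in> unit_set V else z * t ^ nat (- i) \<in> unit_set V)
      \<longleftrightarrow> z / t powi i \<in> unit_set V" for t :: 'a and i :: int
    by (simp add: power_int_def divide_inverse power_inverse)
  show ?thesis unfolding val_def powi
    using unif uniformizer_s by (intro the_equality) blast+
qed

lemma val_unit: "z \<in> L \<Longrightarrow> z \<noteq> 0 \<Longrightarrow> z / s powi val V z \<in> unit_set V"
  using unit_part val_eqI by metis

lemma val_mult:
  assumes "a \<in> L" "b \<in> L" "a \<noteq> 0" "b \<noteq> 0" shows "val V (a * b) = val V a + val V b"
proof (rule val_eqI)
  have "a * b / s powi (val V a + val V b) = (a / s powi val V a) * (b / s powi val V b)"
    using s_nz by (simp add: power_int_add)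
  then show "a * b / s powi (val V a + val V b) \<in> unit_set V"
    using unit_closed(2)[OF val_unit val_unit] assms by simp
qed

lemma val_inverse:
  assumes "a \<in> L" "a \<noteq> 0" shows "val V (inverse a) = - val V a"
proof (rule val_eqI)
  have "inverse a / s powi (- val V a) = inverse (a / s powi val V a)"
    by (simp add: power_int_minus field_simps)
  then show "inverse a / s powi (- val V a) \<in> unit_set V"
    using unit_closed(3)[OF val_unit] assms by simp
qed

lemma val_divide:
  assumes "a \<in> L" "b \<in> L" "a \<noteq> 0" "b \<noteq> 0" shows "val V (a / b) = val V a - val V b"
  using val_mult[of a "inverse b"] val_inverse[of b] assms subfield_closed(6)[OF L]
  by (simp add: divide_inverse)

lemma val_one: "val V 1 = 0"
  by (rule val_eqI) (simp add: unit_closed)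

lemma val_s: "val V s = 1"
  by (rule val_eqI) (use s_nz in \<open>simp add: unit_closed\<close>)

lemma val_power:
  assumes "a \<in> L" "a \<noteq> 0" shows "val V (a ^ n) = int n * val V a"
  by (induction n) (use assms in \<open>auto simp: val_one val_mult subfield_power[OF L] algebra_simps\<close>)

lemma val_powi:
  assumes "a \<in> L" "a \<noteq> 0" shows "val V (a powi n) = n * val V a"
  by (simp add: power_int_def val_power assms subfield_closed(6)[OF L] val_inverse)

lemma in_V_iff: "z \<in> L \<Longrightarrow> z \<noteq> 0 \<Longrightarrow> z \<in> V \<longleftrightarrow> 0 \<le> val V z"
proof -
  assume z: "z \<in> L" "z \<noteq> 0"
  note u = val_unit[OF z]
  have eq: "z = z / s powi val V z * s powi val V z"
    "s powi val V z = z * inverse (z / s powi val V z)" using s_nz z by auto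
  have "z \<in> V \<longleftrightarrow> s powi val V z \<in> V"
    using V_closed(4)[OF unit_setD(1)[OF u], of "s powi val V z"]
      V_closed(4)[of z, OF _ unit_setD(3)[OF u]] eq by metis
  then show ?thesis by (simp add: s_powi_V)
qed

lemma unit_iff: "z \<in> L \<Longrightarrow> z \<noteq> 0 \<Longrightarrow> z \<in> unit_set V \<longleftrightarrow> val V z = 0"
  using in_V_iff[of z] in_V_iff[of "inverse z"] val_inverse[of z] subfield_closed(6)[OF L]
  by (auto simp: unit_set_def)

lemma max_iff: "z \<in> L \<Longrightarrow> z \<noteq> 0 \<Longrightarrow> z \<in> max_ideal V \<longleftrightarrow> 0 < val V z"
  using in_V_iff[of z] in_V_iff[of "inverse z"] val_inverse[of z] subfield_closed(6)[OF L]
  by (auto simp: max_ideal_def)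

text \<open>Zero summands have no meaningful value and are dropped. The others have pairwise
  different values, so one of them dominates and its value, the least one, is that of the
  sum.\<close>

lemma val_dominant:
  assumes I: "finite I" and z: "\<And>i. i \<in> I \<Longrightarrow> z i \<in> L"
    and inj: "\<And>i j. i \<in> I \<Longrightarrow> j \<in> I \<Longrightarrow> z i \<noteq> 0 \<Longrightarrow> z j \<noteq> 0 \<Longrightarrow> val V (z i) = val V (z j) \<Longrightarrow> i = j"
    and i: "i \<in> I" "z i \<noteq> 0"
  shows "sum z I \<noteq> 0 \<and> val V (sum z I) \<le> val V (z i)"
proof -
  define J where "J = {i\<in>I. z i \<noteq> 0}"
  have J: "finite J" "J \<noteq> {}" and zJ: "\<And>i. i \<in> J \<Longrightarrow> z i \<in> L \<and> z i \<noteq> 0"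
    using I i z by (auto simp: J_def)
  have sumJ: "sum z J = sum z I" unfolding J_def using I by (intro sum.mono_neutral_left) auto
  have "z i / z j \<notin> unit_set V" if "i \<in> J" "j \<in> J" "i \<noteq> j" for i j
  proof -
    have "val V (z i) \<noteq> val V (z j)" using that inj[of i j] by (auto simp: J_def)
    moreover have "z i / z j \<in> L" using that zJ by (intro subfield_closed(8)[OF L]) auto
    ultimately show ?thesis
      using val_divide[of "z i" "z j"] unit_iff[of "z i / z j"] zJ[OF that(1)] zJ[OF that(2)] by simp
  qed
  then obtain k where k: "k \<in> J" "sum z I / z k \<in> unit_set V"
    "\<forall>i\<in>J-{k}. z i / z k \<in> max_ideal V"
    using dominant_term[of J z] J zJ sumJ by auto
  have nz: "sum z I \<noteq> 0" using unit_setD(2)[OF k(2)] by auto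
  have sL: "sum z I \<in> L" using z by (intro subfield_sum[OF L])
  have "val V (sum z I) = val V (z k)"
    using unit_iff[of "sum z I / z k"] k(2) unit_setD[OF k(2)] val_divide[of "sum z I" "z k"] nz sL zJ[OF k(1)]
    by auto
  moreover have "val V (z k) \<le> val V (z i)"
  proof (cases "i = k")
    case False
    have iJ: "i \<in> J" using i by (simp add: J_def)
    then have m: "z i / z k \<in> max_ideal V" using k(3) False by auto
    then show ?thesis
      using in_V_iff[of "z i / z k"] val_divide[of "z i" "z k"] zJ[OF iJ] zJ[OF k(1)]
        max_idealD[OF m] by auto
  qed simp
  ultimately show ?thesis using nz by simp
qed

end

section \<open>A valuation ring above a discrete place, in an extension of finite degree\<close>

text \<open>Only the lower ring \<open>W\<close> is assumed discrete; discreteness of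
  \<open>V\<close> is derived from it and from the finite degree.\<close>

locale discrete_extension = base: discrete_place K M W t + valued_subfield K L V
  for K M W :: "'a::field set" and t and L V +
  fixes d :: nat
  assumes base_sub: "M \<subseteq> L" and VM: "V \<inter> M = W" and deg: "ext_degree_is M L d"
begin

lemma base_units: "u \<in> unit_set W \<Longrightarrow> u \<in> unit_set V"
  using VM unit_set_Int[OF base.L, of V] by auto

lemma base_max: "u \<in> max_ideal W \<Longrightarrow> u \<in> max_ideal V"
  using VM max_ideal_Int[OF base.L, of V] by auto

lemma t_L: "t \<in> L"
  using base.s_max base.max_idealD(2) base_sub by blast

text \<open>The powers of \<open>z\<close> up to exponent \<open>d\<close> are dependent over
  \<open>M\<close>. A vanishing sum has no dominant term, so two of its nonzero terms differ by a
  unit factor; their quotient is a power of \<open>z\<close> times an element of \<open>M\<close>,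
  and the latter is a power of \<open>t\<close> times a unit.\<close>

lemma power_commensurable:
  assumes z: "z \<in> L" "z \<noteq> 0"
  shows "\<exists>e k. 1 \<le> e \<and> e \<le> d \<and> z ^ e * t powi k \<in> unit_set V"
proof -
  obtain c where c: "\<forall>i. c i \<in> M" "\<exists>i\<in>{..d}. c i \<noteq> 0" "(\<Sum>i\<in>{..d}. c i * z ^ i) = 0"
    using ext_degree_dependence[OF deg, of "{..d}" "\<lambda>i. z ^ i"] subfield_power[OF L z(1)] by auto
  define J where "J = {i. i \<le> d \<and> c i \<noteq> 0}"
  have J: "finite J" "J \<noteq> {}" using c(2) by (auto simp: J_def)
  have "(\<Sum>i\<in>J. c i * z ^ i) = (\<Sum>i\<in>{..d}. c i * z ^ i)"
    unfolding J_def by (intro sum.mono_neutral_left) auto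
  then have s0: "(\<Sum>i\<in>J. c i * z ^ i) = 0" using c(3) by simp
  have "\<exists>i\<in>J. \<exists>j\<in>J. i \<noteq> j \<and> c i * z ^ i / (c j * z ^ j) \<in> unit_set V"
  proof (rule ccontr)
    assume "\<not> ?thesis"
    moreover have "c i * z ^ i \<in> L" for i
      using c(1) base_sub by (intro subfield_closed(4)[OF L] subfield_power[OF L z(1)]) auto
    moreover have "c i * z ^ i \<noteq> 0" if "i \<in> J" for i using that z by (simp add: J_def)
    ultimately have "\<exists>k\<in>J. (\<Sum>i\<in>J. c i * z ^ i) / (c k * z ^ k) \<in> unit_set V"
      using dominant_term[OF J, of "\<lambda>i. c i * z ^ i"] by meson
    then show False using s0 by (auto simp: unit_set_def)
  qed
  then obtain i j where ij0: "i \<in> J" "j \<in> J" "i \<noteq> j" "c i * z ^ i / (c j * z ^ j) \<in> unit_set V" by blast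
  have "\<exists>i\<in>J. \<exists>j\<in>J. i > j \<and> c i * z ^ i / (c j * z ^ j) \<in> unit_set V"
  proof (cases "i > j")
    case False
    have "c j * z ^ j / (c i * z ^ i) \<in> unit_set V" using unit_closed(3)[OF ij0(4)] by simp
    then show ?thesis using ij0 False by (metis nat_neq_iff)
  qed (use ij0 in blast)
  then obtain i j where ij: "i \<in> J" "j \<in> J" "i > j" "c i * z ^ i / (c j * z ^ j) \<in> unit_set V" by blast
  define a where "a = c i / c j"
  have a: "a \<in> M" "a \<noteq> 0" using ij c(1) subfield_closed(8)[OF base.L] by (auto simp: a_def J_def)
  then obtain n where n: "a / t powi n \<in> unit_set W" using base.unit_part by blast
  have "z ^ (i - j) * t powi n = (c i * z ^ i / (c j * z ^ j)) / (a / t powi n)"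
    using ij(3) z a by (simp add: a_def power_diff)
  also have "\<dots> \<in> unit_set V" by (rule unit_closed(4)[OF ij(4) base_units[OF n]])
  finally show ?thesis using ij by (intro exI[of _ "i - j"] exI[of _ n]) (auto simp: J_def)
qed

text \<open>In terms of values, \<open>e\<close> times the value of \<open>z\<close> is a positive
  multiple of the value of \<open>t\<close>, with \<open>e \<le> d\<close>. So \<open>t\<close>
  cannot be divisible by a power of \<open>z\<close> beyond the \<open>d\<close>-th.\<close>

lemma power_dividing_t_bounded:
  assumes z: "z \<in> max_ideal V" "z \<noteq> 0" and N: "t / z ^ N \<in> V"
  shows "N \<le> d"
proof (rule ccontr)
  assume "\<not> N \<le> d"
  have zV: "z \<in> V" "z \<in> L" using z max_idealD by auto
  obtain e k where e: "1 \<le> e" "e \<le> d" "z ^ e * t powi k \<in> unit_set V"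
    using power_commensurable[OF zV(2) z(2)] by blast
  have tV: "t \<in> V" using base_max[OF base.s_max] max_idealD by blast
  show False
  proof (cases "k \<ge> 0")
    case True
    then have "t powi k \<in> V" using V_power[OF tV] by (simp add: power_int_def)
    then have "z ^ e * t powi k \<in> max_ideal V" using max_mult max_power z e by auto
    then show False using e unit_setD by blast
  next
    case False
    have "inverse (z ^ e * t powi k) = t powi (-k) / z ^ e"
      by (simp add: power_int_minus field_simps)
    also have "\<dots> = (t / z ^ N * t powi (-k - 1)) * z ^ (N - e)"
      using z base.s_nz e \<open>\<not> N \<le> d\<close> by (simp add: power_diff power_int_diff)
    also have "\<dots> \<in> max_ideal V"
    proof (intro max_mult' V_closed(4) N max_power z(1))
      show "t powi (-k - 1) \<in> V" using False V_power[OF tV] by (simp add: power_int_def)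
      show "0 < N - e" using e \<open>\<not> N \<le> d\<close> by simp
    qed
    finally show False using unit_closed(3)[OF e(3)] unit_setD(5) by blast
  qed
qed

text \<open>Let \<open>N\<close> be the largest exponent such that \<open>t\<close> is divisible by
  an \<open>N\<close>-th power from the maximal ideal, and \<open>s\<close> the base of such a
  power. If \<open>s\<close> did not divide some \<open>z\<close> of the maximal ideal, then the
  square of \<open>z\<close> or of \<open>s / z\<close> would divide \<open>s\<close>, and
  \<open>2 * N\<close> would be a larger exponent. So \<open>s\<close> generates the maximal
  ideal.\<close>

lemma discrete: "\<exists>s. discrete_place K L V s"
proof -
  define Q where "Q N \<longleftrightarrow> (\<exists>z. z \<in> max_ideal V \<and> z \<noteq> 0 \<and> t / z ^ N \<in> V)" for N
  have Q1: "Q 1" unfolding Q_def using base_max[OF base.s_max] base.s_nz V_closed by auto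
  have "\<forall>N. Q N \<longrightarrow> N \<le> d" unfolding Q_def using power_dividing_t_bounded by blast
  then obtain N where N: "Q N" "\<forall>N'. Q N' \<longrightarrow> N' \<le> N" using ex_has_greatest_nat[of Q 1 "\<lambda>n. n"] Q1
    by (metis less_Suc_eq_le)
  have N1: "N \<ge> 1" using N(2) Q1 by blast
  obtain s where s: "s \<in> max_ideal V" "s \<noteq> 0" "t / s ^ N \<in> V" using N(1) by (auto simp: Q_def)
  have sL: "s \<in> L" using s max_idealD by blast
  have half: False if w: "w \<in> max_ideal V" "w \<noteq> 0" "s / w ^ 2 \<in> V" for w
  proof -
    have "t / w ^ (2 * N) = t / s ^ N * (s / w ^ 2) ^ N"
      using s by (simp add: power_mult power_divide)
    also have "\<dots> \<in> V" using s w by (intro V_closed(4) V_power)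
    finally have "Q (2 * N)" using w by (auto simp: Q_def)
    then show False using N(2) N1 by fastforce
  qed
  have div_s: "z / s \<in> V" if z: "z \<in> max_ideal V" for z
  proof (rule ccontr)
    assume n: "z / s \<notin> V"
    then have z0: "z \<noteq> 0" using V_closed by auto
    have zL: "z \<in> L" using z max_idealD by blast
    have w: "s / z \<in> max_ideal V" using not_in_V[OF _ n] subfield_closed(8)[OF L zL sL] by simp
    have "s / z ^ 2 \<in> L" using subfield_closed(8)[OF L sL subfield_power[OF L zL]] .
    then consider "s / z ^ 2 \<in> V" | "z ^ 2 / s \<in> V"
      using in_V_or_inverse[of "s / z ^ 2"] s z0 by auto
    then show False
    proof cases
      case 2
      have "s / (s / z) ^ 2 = z ^ 2 / s" using s z0 by (simp add: power2_eq_square)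
      then show False using half[OF w] s z0 2 by auto
    qed (use half z z0 in blast)
  qed
  have tN: "t / s ^ N \<in> unit_set V"
  proof (rule ccontr)
    assume "t / s ^ N \<notin> unit_set V"
    then have "t / s ^ N / s \<in> V" using div_s unit_or_max s by blast
    then have "Q (Suc N)" using s unfolding Q_def by (intro exI[of _ s]) (simp add: field_simps)
    then show False using N(2) by fastforce
  qed
  have bounded: "\<exists>n. z / s ^ n \<notin> V" if z: "z \<in> V" "z \<noteq> 0" for z
  proof (rule ccontr)
    assume "\<nexists>n. z / s ^ n \<notin> V"
    then have all: "z / s ^ n \<in> V" for n by blast
    obtain e k where e: "1 \<le> e" "e \<le> d" "z ^ e * t powi k \<in> unit_set V"
      using power_commensurable[OF in_L[OF z(1)] z(2)] by blast
    \<comment> \<open>Up to a unit, \<open>z ^ e\<close> is \<open>s powi (- N * k)\<close>. With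
      \<open>n\<close> beyond the absolute value of this exponent, divisibility of \<open>z\<close>
      by \<open>s ^ n\<close> would put a negative power of \<open>s\<close> into
      \<open>V\<close>.\<close>
    define n where "n = nat (int N * \<bar>k\<bar> + 1)"
    have "int N * k \<ge> - (int N * \<bar>k\<bar>)" using mult_left_mono[of "-\<bar>k\<bar>" k "int N"] by simp
    then have n_pos: "int N * k + int n > 0" by (simp add: n_def)
    have u: "z ^ e * s powi (int N * k) \<in> unit_set V"
    proof -
      have "z ^ e * s powi (int N * k) = z ^ e * t powi k / (t / s ^ N) powi k"
        using s base.s_nz by (simp add: power_int_mult power_int_divide_distrib)
      then show ?thesis using unit_closed(4)[OF e(3) unit_power_int[OF tN]] by simp
    qed
    have "s powi (- (int N * k) - int n) = z / s ^ n * z ^ (e - 1) * inverse (z ^ e * s powi (int N * k))"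
      using s z e by (simp add: power_int_diff power_int_minus power_diff field_simps)
    also have "\<dots> \<in> V" using all unit_setD(3)[OF u] V_power[OF z(1)] by (intro V_closed(4))
    finally have "inverse (s ^ nat (int N * k + int n)) \<in> V"
      using n_pos by (simp add: power_int_def) (simp add: power_inverse add.commute)
    then show False using inverse_max_ideal[OF max_power[OF s(1)], of "nat (int N * k + int n)"] s n_pos by auto
  qed
  show ?thesis
  proof (intro exI, unfold_locales)
    fix z assume z: "z \<in> L" "z \<noteq> 0"
    have *: "\<exists>n. z / s ^ n \<in> unit_set V" if z: "z \<in> V" "z \<noteq> 0" for z
    proof -
      define n where "n = (LEAST n. z / s ^ n \<notin> V)"
      have n: "z / s ^ n \<notin> V" unfolding n_def using LeastI_ex[OF bounded[OF z]] .
      then obtain n' where n': "n = Suc n'" using z by (cases n) auto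
      have V: "z / s ^ n' \<in> V" using not_less_Least[of n' "\<lambda>n. z / s ^ n \<notin> V"] n' n_def by auto
      have "z / s ^ n' \<notin> max_ideal V" using div_s[of "z / s ^ n'"] n n' by (auto simp: field_simps)
      then show ?thesis using V unit_or_max by blast
    qed
    show "\<exists>n. z / s powi n \<in> unit_set V"
    proof (cases "z \<in> V")
      case True
      then obtain n where "z / s ^ n \<in> unit_set V" using * z by blast
      then show ?thesis by (intro exI[of _ "int n"]) simp
    next
      case False
      then have "inverse z \<in> V" using in_V_or_inverse z by blast
      then obtain n where "inverse z / s ^ n \<in> unit_set V" using *[of "inverse z"] z by auto
      then have "inverse (inverse z / s ^ n) \<in> unit_set V" by (rule unit_closed)
      then show ?thesis by (intro exI[of _ "- int n"]) (simp add: power_int_minus divide_inverse mult.commute)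
    qed
  qed (use s in auto)
qed

text \<open>The power of \<open>s\<close> with exponent \<open>val V t\<close> divides
  \<open>t\<close>, which bounds this exponent by \<open>d\<close>. Here \<open>val V t\<close> is
  the ramification index, and multiplication by it turns values at \<open>W\<close> into values at
  \<open>V\<close>, since units of \<open>W\<close> remain units.\<close>

lemma ramification:
  assumes "discrete_place K L V s"
  shows "1 \<le> val V t" "val V t \<le> int d"
    "\<And>a. a \<in> M \<Longrightarrow> a \<noteq> 0 \<Longrightarrow> val V a = val V t * val W a"
proof -
  interpret E: discrete_place K L V s by fact
  show e: "1 \<le> val V t" using E.max_iff[OF t_L base.s_nz] base_max[OF base.s_max] by simp
  have "val V (t / s ^ nat (val V t)) = 0"
    using e E.val_divide[OF t_L subfield_power[OF L max_idealD(2)[OF E.s_max]]] base.s_nz E.s_nz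
      E.val_power[OF max_idealD(2)[OF E.s_max]] E.val_s by simp
  then have "t / s ^ nat (val V t) \<in> V"
    using E.in_V_iff[of "t / s ^ nat (val V t)"] base.s_nz E.s_nz
      subfield_closed(8)[OF L t_L subfield_power[OF L max_idealD(2)[OF E.s_max]]] by simp
  then show "val V t \<le> int d"
    using power_dividing_t_bounded[OF E.s_max E.s_nz] e by fastforce
  fix a assume a: "a \<in> M" "a \<noteq> 0"
  then have u: "a / t powi val W a \<in> unit_set V" using base_units[OF base.val_unit] by blast
  then have "val V (a / t powi val W a) = 0"
    using E.unit_iff[of "a / t powi val W a"] unit_setD[OF u] by blast
  then show "val V a = val V t * val W a"
    using E.val_divide[of a "t powi val W a"] a base_sub subfield_power_int[OF L t_L] base.s_nz
      E.val_powi[OF t_L] by auto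
qed

end

section \<open>Total ramification\<close>

locale totally_ramified_extension = discrete_extension +
  fixes s
  assumes top_discrete: "discrete_place K L V s" and total: "val V t = int d"
begin

sublocale top: discrete_place K L V s
  by (rule top_discrete)

lemma d_pos: "d > 0"
  using ramification(1)[OF top_discrete] total by simp

lemma val_base: "a \<in> M \<Longrightarrow> a \<noteq> 0 \<Longrightarrow> val V a = int d * val W a"
  using ramification(3)[OF top_discrete] total by simp

lemma val_term:
  assumes "y \<in> L" "y \<noteq> 0" "a \<in> M" "a \<noteq> 0"
  shows "val V (a * y ^ j) = int d * val W a + int j * val V y"
  using top.val_mult[of a "y ^ j"] assms base_sub subfield_power[OF L] val_base top.val_power by auto

text \<open>Elements of \<open>M\<close> have values divisible by \<open>d\<close>. Equal values of
  two terms would force \<open>d\<close> to divide \<open>(j - l) * val V y\<close>, hence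
  \<open>j - l\<close> by coprimality, which is impossible for distinct indices below
  \<open>d\<close>. So nothing cancels.\<close>

lemma power_sum_val:
  assumes y: "y \<in> L" "y \<noteq> 0" and cop: "coprime (val V y) (int d)"
    and a: "\<And>j. j < d \<Longrightarrow> a j \<in> M" and i: "i < d" "a i \<noteq> 0"
  shows "(\<Sum>j<d. a j * y ^ j) \<noteq> 0 \<and> val V (\<Sum>j<d. a j * y ^ j) \<le> val V (a i * y ^ i)"
proof (rule top.val_dominant)
  fix j l assume jl: "j \<in> {..<d}" "l \<in> {..<d}" "a j * y ^ j \<noteq> 0" "a l * y ^ l \<noteq> 0"
    and "val V (a j * y ^ j) = val V (a l * y ^ l)"
  then have "int d * val W (a j) + int j * val V y = int d * val W (a l) + int l * val V y"
    using val_term[OF y] a by auto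
  then have "(int j - int l) * val V y = int d * (val W (a l) - val W (a j))"
    by (simp add: algebra_simps)
  then have "int d dvd (int j - int l) * val V y" by simp
  then have "int d dvd int j - int l"
    using cop by (simp add: coprime_commute coprime_dvd_mult_left_iff)
  then show "j = l" using jl zdvd_not_zless[of "\<bar>int j - int l\<bar>" "int d"] by fastforce
qed (use y a i base_sub in \<open>auto intro!: subfield_closed(4)[OF L] subfield_power[OF L]\<close>)

lemma power_coeffs_unique:
  assumes y: "y \<in> L" "y \<noteq> 0" and cop: "coprime (val V y) (int d)"
    and a: "\<And>j. j < d \<Longrightarrow> a j \<in> M" and b: "\<And>j. j < d \<Longrightarrow> b j \<in> M"
    and eq: "(\<Sum>j<d. a j * y ^ j) = (\<Sum>j<d. b j * y ^ j)" and i: "i < d"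
  shows "a i = b i"
proof (rule ccontr)
  assume "a i \<noteq> b i"
  then have "(\<Sum>j<d. (a j - b j) * y ^ j) \<noteq> 0"
    using power_sum_val[OF y cop, of "\<lambda>j. a j - b j" i] a b i subfield_closed(7)[OF base.L] by auto
  then show False using eq by (simp add: algebra_simps sum_subtractf)
qed

text \<open>The value 1 of \<open>s\<close> is coprime to \<open>d\<close>, so its powers below
  \<open>d\<close> are independent over \<open>M\<close>; a dependence among them and
  \<open>z\<close> must involve \<open>z\<close>.\<close>

lemma uniformizer_powers_span:
  assumes z: "z \<in> L"
  shows "\<exists>a. (\<forall>j<d. a j \<in> M) \<and> z = (\<Sum>j<d. a j * s ^ j)"
proof -
  have s: "s \<in> L" "s \<noteq> 0" "coprime (val V s) (int d)"
    using max_idealD(2)[OF top.s_max] top.s_nz top.val_s by auto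
  define w where "w i = (if i = d then z else s ^ i)" for i
  have wL: "w i \<in> L" for i using z subfield_power[OF L s(1)] by (simp add: w_def)
  obtain c where c: "\<forall>i. c i \<in> M" "\<exists>i\<in>{..d}. c i \<noteq> 0" "(\<Sum>i\<in>{..d}. c i * w i) = 0"
    using ext_degree_dependence[OF deg, of "{..d}" w] wL by auto
  have "(\<Sum>i\<in>{..d}. c i * w i) = c d * z + (\<Sum>i<d. c i * s ^ i)"
    by (simp add: lessThan_Suc_atMost[symmetric] w_def)
  then have eq: "c d * z + (\<Sum>i<d. c i * s ^ i) = 0" using c(3) by metis
  have cd: "c d \<noteq> 0"
  proof
    assume "c d = 0"
    moreover obtain i where "i \<le> d" "c i \<noteq> 0" using c(2) by auto
    ultimately have "i < d" "c i \<noteq> 0" by (auto simp: le_less)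
    then show False using power_sum_val[OF s, of c i] c(1) eq \<open>c d = 0\<close> by auto
  qed
  have "z = (\<Sum>j<d. (- c j / c d) * s ^ j)"
    using eq cd by (simp add: sum_divide_distrib[symmetric] sum_negf field_simps add_eq_0_iff)
  then show ?thesis using c(1) subfield_closed(5,8)[OF base.L] by (intro exI[of _ "\<lambda>j. - c j / c d"]) auto
qed

text \<open>No term has smaller value than the sum, so \<open>d * val W (a i) + i \<ge> 0\<close>
  for nonzero \<open>a i\<close>. Since \<open>i < d\<close>, the integer \<open>val W (a i)\<close>
  cannot be negative.\<close>

lemma uniformizer_powers_integral:
  assumes z: "z \<in> V"
  shows "\<exists>a. (\<forall>j<d. a j \<in> W) \<and> z = (\<Sum>j<d. a j * s ^ j)"
proof -
  have s: "s \<in> L" "s \<noteq> 0" "coprime (val V s) (int d)"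
    using max_idealD(2)[OF top.s_max] top.s_nz top.val_s by auto
  obtain a where a: "\<forall>j<d. a j \<in> M" "z = (\<Sum>j<d. a j * s ^ j)"
    using uniformizer_powers_span[OF in_L[OF z]] by blast
  have "a i \<in> W" if i: "i < d" for i
  proof (cases "a i = 0")
    case False
    have "z \<noteq> 0" "val V z \<le> val V (a i * s ^ i)"
      using power_sum_val[OF s, of a i] a i False by auto
    then have "0 \<le> int d * val W (a i) + int i"
      using top.in_V_iff[OF in_L[OF z]] z val_term[OF s(1,2), of "a i" i] a(1) i False top.val_s by auto
    moreover have "int d * val W (a i) \<le> int d * (-1)" if "val W (a i) < 0"
      using that by (intro mult_left_mono) auto
    ultimately have "0 \<le> val W (a i)" using i by (cases "val W (a i) < 0") auto
    then show ?thesis using base.in_V_iff[of "a i"] a i False by auto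
  qed (simp add: base.V_closed)
  then show ?thesis using a(2) by blast
qed

text \<open>The uniformizer is a root of an Eisenstein polynomial over the valuation ring below, hence
  lies in every valuation ring above it.\<close>
lemma place_above_unique:
  assumes V': "valued_subfield K L V'" and below: "V' \<inter> M = W"
  shows "V' = V"
proof -
  interpret V': valued_subfield K L V' by fact
  have W: "W \<subseteq> V'" using below by blast
  have s: "s \<in> L" "s \<in> V" "s \<noteq> 0" using max_idealD[OF top.s_max] top.s_nz by auto
  have sV': "s \<in> V'"
  proof -
    obtain a where "\<forall>j<d. a j \<in> W" "s ^ d = (\<Sum>j<d. a j * s ^ j)"
      using uniformizer_powers_integral[OF V_power[OF s(2)]] by blast
    then show ?thesis using V'.integral_in_V[OF s(1), of d a] W by blast
  qed
  have sub: "V \<subseteq> V'"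
  proof
    fix z assume "z \<in> V"
    then obtain a where "\<forall>j<d. a j \<in> W" "z = (\<Sum>j<d. a j * s ^ j)"
      using uniformizer_powers_integral by blast
    then show "z \<in> V'" using W V'.V_power[OF sV'] by (auto intro!: V'.V_sum V'.V_closed(4))
  qed
  \<comment> \<open>A discrete valuation ring is maximal among proper subrings: an element outside
    \<open>V\<close> would bring \<open>inverse s\<close> into \<open>V'\<close>, and then every
    power of \<open>s\<close> and all of \<open>L\<close>.\<close>
  have "z \<in> V" if z: "z \<in> V'" for z
  proof (rule ccontr)
    assume n: "z \<notin> V"
    then have z0: "z \<noteq> 0" using V_closed by auto
    then have v: "val V z < 0" using n top.in_V_iff[OF V'.in_L[OF z]] by simp
    have u: "z / s powi val V z \<in> unit_set V" using top.val_unit[OF V'.in_L[OF z] z0] .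
    have "s powi (- val V z - 1) \<in> V" using v by (simp add: top.s_powi_V)
    then have "z * (inverse (z / s powi val V z) * s powi (- val V z - 1)) \<in> V'"
      using z sub unit_setD(3)[OF u] by (intro V'.V_closed(4)) auto
    also have "z * (inverse (z / s powi val V z) * s powi (- val V z - 1)) = inverse s"
      using z0 s by (simp add: power_int_diff power_int_minus field_simps)
    finally have inv_s: "inverse s \<in> V'" .
    have "w \<in> V'" if w: "w \<in> L" for w
    proof (cases "w = 0")
      case False
      have pw: "s powi i \<in> V'" for i
        using V'.V_power[OF sV'] V'.V_power[OF inv_s] by (simp add: power_int_def)
      have "w / s powi val V w * s powi val V w \<in> V'"
        using unit_setD(1)[OF top.val_unit[OF w False]] pw sub by (intro V'.V_closed(4)) auto
      then show ?thesis using s by simp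
    qed (simp add: V'.V_closed)
    then show False using V'.pl by (auto simp: place_def)
  qed
  with sub show ?thesis by blast
qed

text \<open>Each \<open>R\<close> comes with its own coefficients, but they all lie in
  \<open>M\<close>, where the expansion in powers of \<open>y\<close> is unique. One choice
  therefore serves for all of \<open>PP\<close>.\<close>

lemma common_coeffs:
  assumes y: "y \<in> L" "y \<noteq> 0" and cop: "coprime (val V y) (int d)"
    and ne: "PP \<noteq> {}" and sub: "\<And>R. R \<in> PP \<Longrightarrow> R \<subseteq> M"
    and rep: "\<And>R. R \<in> PP \<Longrightarrow> z \<in> {\<Sum>j<d. a j * y ^ j | a. \<forall>j<d. a j \<in> R}"
  shows "\<exists>a. (\<forall>j<d. a j \<in> M \<and> (\<forall>R\<in>PP. a j \<in> R)) \<and> z = (\<Sum>j<d. a j * y ^ j)"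
proof -
  obtain R where R: "R \<in> PP" using ne by blast
  then obtain a where a: "z = (\<Sum>j<d. a j * y ^ j)" "\<forall>j<d. a j \<in> R" using rep by blast
  have aM: "a j \<in> M" if "j < d" for j using a sub R that by blast
  have "a j \<in> R'" if j: "j < d" and R': "R' \<in> PP" for j R'
  proof -
    obtain b where b: "z = (\<Sum>j<d. b j * y ^ j)" "\<forall>j<d. b j \<in> R'" using rep R' by blast
    have "a j = b j"
      by (rule power_coeffs_unique[OF y cop aM _ _ j]) (use b sub[OF R'] a(1) in auto)
    then show ?thesis using b j by simp
  qed
  then show ?thesis using a aM by blast
qed

text \<open>Without cancellation the value of \<open>z\<close> bounds the value of each term from
  below, and the factor \<open>y ^ i\<close>, of value at most 0, only helps. Dividing by
  \<open>d\<close> gives the pole bound for the coefficients one level down.\<close>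

lemma coeff_val_ge:
  assumes y: "y \<in> L" "y \<noteq> 0" and cop: "coprime (val V y) (int d)" and neg: "val V y \<le> 0"
    and a: "\<And>j. j < d \<Longrightarrow> a j \<in> M" and z: "z = (\<Sum>j<d. a j * y ^ j)"
    and ge: "z \<noteq> 0 \<Longrightarrow> - (N * int d) \<le> val V z" and i: "i < d" "a i \<noteq> 0"
  shows "- N \<le> val W (a i)"
proof -
  have *: "z \<noteq> 0" "val V z \<le> val V (a i * y ^ i)"
    using power_sum_val[OF y cop, of a i] a i z by auto
  have "- (N * int d) \<le> int d * val W (a i) + int i * val V y"
    using ge[OF *(1)] *(2) val_term[OF y, of "a i" i] a i by simp
  also have "\<dots> \<le> int d * val W (a i)" using neg by (simp add: mult_nonneg_nonpos)
  finally have "int d * (- N) \<le> int d * val W (a i)" by (simp add: mult.commute)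
  then show ?thesis using d_pos by (subst (asm) mult_le_cancel_left_pos) auto
qed

end

section \<open>The rational function field\<close>

text \<open>As \<open>K\<close> is a set inside a larger field, its polynomial ring is a set of
  polynomials over that field, and division must be shown not to leave it.\<close>

definition poly_over :: "'a::field set \<Rightarrow> 'a poly set" where
  "poly_over K = {f. set (coeffs f) \<subseteq> K}"

lemma poly_over_iff: "subfield K \<Longrightarrow> f \<in> poly_over K \<longleftrightarrow> (\<forall>n. coeff f n \<in> K)"
proof
  assume K: "subfield K" and f: "f \<in> poly_over K"
  show "\<forall>n. coeff f n \<in> K"
  proof
    fix n
    show "coeff f n \<in> K"
      using f K coeff_in_coeffs[of f n] coeff_eq_0[of f n] unfolding poly_over_def
      by (cases "f = 0 \<or> n > degree f") (auto simp: subfield_def)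
  qed
next
  assume "\<forall>n. coeff f n \<in> K"
  then show "f \<in> poly_over K" by (auto simp: poly_over_def coeffs_def split: if_splits)
qed

lemma poly_over_closed:
  assumes K: "subfield K"
  shows "0 \<in> poly_over K" "1 \<in> poly_over K" "c \<in> K \<Longrightarrow> [:c:] \<in> poly_over K"
    "[:0, 1:] \<in> poly_over K"
    "f \<in> poly_over K \<Longrightarrow> g \<in> poly_over K \<Longrightarrow> f + g \<in> poly_over K"
    "f \<in> poly_over K \<Longrightarrow> g \<in> poly_over K \<Longrightarrow> f * g \<in> poly_over K"
    "f \<in> poly_over K \<Longrightarrow> - f \<in> poly_over K"
    "f \<in> poly_over K \<Longrightarrow> g \<in> poly_over K \<Longrightarrow> f - g \<in> poly_over K"
    "c \<in> K \<Longrightarrow> f \<in> poly_over K \<Longrightarrow> smult c f \<in> poly_over K"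
    "c \<in> K \<Longrightarrow> monom c n \<in> poly_over K"
  using subfield_closed[OF K]
  by (auto simp: poly_over_iff[OF K] coeff_mult coeff_pCons intro!: subfield_sum[OF K] split: nat.splits)

lemma poly_in_subfield:
  assumes "subfield K" "f \<in> poly_over K" "c \<in> K" shows "poly f c \<in> K"
  using assms by (auto simp: poly_altdef poly_over_iff intro!: subfield_sum subfield_closed(4) subfield_power)

lemma poly_over_division:
  assumes K: "subfield K" and g: "g \<in> poly_over K" "g \<noteq> 0" and f: "f \<in> poly_over K"
  shows "\<exists>q\<in>poly_over K. \<exists>r\<in>poly_over K. f = q * g + r \<and> (r = 0 \<or> degree r < degree g)"
  using f
proof (induction "degree f" arbitrary: f rule: less_induct)
  case less
  note cl = poly_over_closed[OF K]
  show ?case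
  proof (cases "f = 0 \<or> degree f < degree g")
    case True
    then show ?thesis using less.prems cl(1) by (intro bexI[of _ 0] bexI[of _ f]) auto
  next
    case False
    then have f0: "f \<noteq> 0" and dg: "degree g \<le> degree f" by auto
    define c where "c = lead_coeff f / lead_coeff g"
    have cK: "c \<in> K" unfolding c_def using less.prems g poly_over_iff[OF K] subfield_closed(8)[OF K] by blast
    have c0: "c \<noteq> 0" using f0 g by (simp add: c_def)
    define h where "h = monom c (degree f - degree g)"
    have h: "h \<in> poly_over K" unfolding h_def by (rule cl(10)[OF cK])
    define f' where "f' = f - h * g"
    have f'K: "f' \<in> poly_over K" unfolding f'_def by (rule cl(8)[OF less.prems cl(6)[OF h g(1)]])
    have deg_hg: "degree (h * g) = degree f"
      using c0 g dg by (simp add: h_def degree_mult_eq degree_monom_eq)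
    have lc: "coeff (h * g) (degree f) = lead_coeff f"
      using deg_hg lead_coeff_mult[of h g] g c0 by (simp add: h_def c_def lead_coeff_monom degree_monom_eq)
    have "\<exists>q\<in>poly_over K. \<exists>r\<in>poly_over K. f' = q * g + r \<and> (r = 0 \<or> degree r < degree g)"
    proof (cases "f' = 0")
      case True
      then show ?thesis using cl(1) by (intro bexI[of _ 0] bexI[of _ 0]) auto
    next
      case False
      have "degree f' \<le> degree f" unfolding f'_def using deg_hg by (metis degree_diff_le order_refl)
      moreover have "coeff f' (degree f) = 0" using lc by (simp add: f'_def)
      then have "degree f' \<noteq> degree f" using False by (metis leading_coeff_0_iff)
      ultimately show ?thesis using less.hyps[of f'] f'K by simp
    qed
    then obtain q r where qr: "q \<in> poly_over K" "r \<in> poly_over K" "f' = q * g + r"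
      "r = 0 \<or> degree r < degree g" by blast
    then have "f = (q + h) * g + r" by (simp add: f'_def algebra_simps)
    then show ?thesis using qr cl(5)[OF qr(1) h] by blast
  qed
qed

text \<open>A nonzero element of least degree divides every other one, because the remainder stays
  in the ideal.\<close>

lemma poly_ideal_generator:
  assumes K: "subfield K" and I: "I \<subseteq> poly_over K" "\<exists>f\<in>I. f \<noteq> 0"
    and add: "\<And>f g. f \<in> I \<Longrightarrow> g \<in> I \<Longrightarrow> f - g \<in> I"
    and mult: "\<And>f g. f \<in> I \<Longrightarrow> g \<in> poly_over K \<Longrightarrow> g * f \<in> I"
  shows "\<exists>h\<in>I. h \<noteq> 0 \<and> (\<forall>f\<in>I. \<exists>q\<in>poly_over K. f = q * h)"
proof -
  obtain h where h: "h \<in> I" "h \<noteq> 0" "\<And>f. f \<in> I \<Longrightarrow> f \<noteq> 0 \<Longrightarrow> degree h \<le> degree f"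
    using ex_has_least_nat[of "\<lambda>f. f \<in> I \<and> f \<noteq> 0" _ degree] I(2) by blast
  have "\<exists>q\<in>poly_over K. f = q * h" if f: "f \<in> I" for f
  proof -
    obtain q r where qr: "q \<in> poly_over K" "r \<in> poly_over K" "f = q * h + r" "r = 0 \<or> degree r < degree h"
      using poly_over_division[OF K _ h(2)] I(1) h(1) f by blast
    have "f - q * h \<in> I" using add[OF f mult[OF h(1) qr(1)]] .
    then have "r \<in> I" using qr(3) by simp
    then have "r = 0" using qr(4) h(3)[of r] by (meson leD)
    then show ?thesis using qr by auto
  qed
  then show ?thesis using h by blast
qed

locale rational_field =
  fixes K :: "'a::field set" and x :: 'a
  assumes K: "subfield K" and transc: "\<not> algebraic_over K x"
begin

abbreviation "F \<equiv> rat_fun_field K x"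

lemmas pcl = poly_over_closed[OF K]

lemma poly_x_eq_0: "f \<in> poly_over K \<Longrightarrow> poly f x = 0 \<longleftrightarrow> f = 0"
  using transc by (auto simp: algebraic_over_def poly_over_def)

lemma poly_x_inj: "f \<in> poly_over K \<Longrightarrow> g \<in> poly_over K \<Longrightarrow> poly f x = poly g x \<longleftrightarrow> f = g"
  using poly_x_eq_0[OF pcl(8)[of f g]] by simp

lemma F_iff: "z \<in> F \<longleftrightarrow> (\<exists>f\<in>poly_over K. \<exists>g\<in>poly_over K. g \<noteq> 0 \<and> z = poly f x / poly g x)"
  unfolding rat_fun_field_def using poly_x_eq_0 by (simp add: poly_over_def) blast

lemma poly_in_F: "f \<in> poly_over K \<Longrightarrow> poly f x \<in> F"
  unfolding F_iff using pcl(2) by (intro bexI[of _ f] bexI[of _ 1]) auto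

lemma fraction_in_F: "f \<in> poly_over K \<Longrightarrow> g \<in> poly_over K \<Longrightarrow> poly f x / poly g x \<in> F"
  by (cases "g = 0") (use F_iff poly_in_F[OF pcl(1)] in auto)

lemma K_sub_F: "K \<subseteq> F"
  using poly_in_F[OF pcl(3)] by auto

lemma x_in_F: "x \<in> F"
  using poly_in_F[OF pcl(4)] by simp

lemma x_nz: "x \<noteq> 0"
  using poly_x_eq_0[OF pcl(4)] by auto

lemma subfield_F: "subfield F"
  unfolding subfield_def
proof (intro conjI ballI)
  show "0 \<in> F" "1 \<in> F" using K_sub_F subfield_closed[OF K] by auto
  fix a assume "a \<in> F"
  then obtain f g where fg: "f \<in> poly_over K" "g \<in> poly_over K" "g \<noteq> 0" "a = poly f x / poly g x"
    using F_iff by blast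
  show "- a \<in> F" using fraction_in_F[OF pcl(7)[OF fg(1)] fg(2)] fg by simp
  show "inverse a \<in> F" using fraction_in_F[OF fg(2,1)] fg by simp
  fix b assume "b \<in> F"
  then obtain f' g' where fg': "f' \<in> poly_over K" "g' \<in> poly_over K" "g' \<noteq> 0" "b = poly f' x / poly g' x"
    using F_iff by blast
  have nz: "poly g x \<noteq> 0" "poly g' x \<noteq> 0" using fg fg' poly_x_eq_0 by auto
  have "a + b = poly (f * g' + f' * g) x / poly (g * g') x"
    unfolding fg(4) fg'(4) using nz by (simp add: field_simps)
  also have "\<dots> \<in> F" using fg fg' by (intro fraction_in_F pcl)
  finally show "a + b \<in> F" .
  have "a * b = poly (f * f') x / poly (g * g') x"
    unfolding fg(4) fg'(4) using nz by (simp add: field_simps)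
  also have "\<dots> \<in> F" using fg fg' by (intro fraction_in_F pcl)
  finally show "a * b \<in> F" .
qed

section \<open>The place of the rational function field at infinity\<close>

text \<open>Division by \<open>x ^ degree f\<close> gives a polynomial in \<open>inverse x\<close>,
  an element of the maximal ideal, whose constant term is the leading coefficient of
  \<open>f\<close>, a nonzero constant and hence a unit.\<close>

lemma poly_val_infinity:
  assumes V: "valued_subfield K F V" and x: "x \<notin> V" and f: "f \<in> poly_over K" "f \<noteq> 0"
  shows "poly f x / x ^ degree f \<in> unit_set V"
proof -
  interpret valued_subfield K F V by fact
  have m: "inverse x \<in> max_ideal V" using not_in_V[OF x_in_F x] .
  have "poly f x / x ^ degree f = (\<Sum>i\<le>degree f. coeff f i * inverse x ^ (degree f - i))"
    unfolding poly_altdef sum_divide_distrib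
    by (intro sum.cong refl) (use x_nz in \<open>simp add: power_diff field_simps power_inverse\<close>)
  also have "\<dots> = lead_coeff f + (\<Sum>i<degree f. coeff f i * inverse x ^ (degree f - i))"
    by (simp add: lessThan_Suc_atMost[symmetric])
  also have "\<dots> \<in> unit_set V"
  proof (rule unit_add_max)
    show "lead_coeff f \<in> unit_set V" using f poly_over_iff[OF K, of f] K_unit by simp
    show "(\<Sum>i<degree f. coeff f i * inverse x ^ (degree f - i)) \<in> max_ideal V"
      using f(1) poly_over_iff[OF K, of f] m K_in by (intro max_sum max_mult' max_power) auto
  qed
  finally show ?thesis .
qed

lemma fraction_val_infinity:
  assumes V: "valued_subfield K F V" and x: "x \<notin> V" and f: "f \<in> poly_over K" "f \<noteq> 0"
    and g: "g \<in> poly_over K" "g \<noteq> 0"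
  shows "poly f x / poly g x / inverse x powi (int (degree g) - int (degree f)) \<in> unit_set V"
proof -
  interpret valued_subfield K F V by fact
  have "poly f x / poly g x / inverse x powi (int (degree g) - int (degree f))
      = (poly f x / x ^ degree f) / (poly g x / x ^ degree g)"
    using x_nz by (simp add: power_int_diff field_simps power_inverse)
  then show ?thesis using unit_closed(4)[OF poly_val_infinity[OF V x f] poly_val_infinity[OF V x g]] by metis
qed

lemma infinity_discrete:
  assumes V: "valued_subfield K F V" and x: "x \<notin> V"
  shows "discrete_place K F V (inverse x)"
proof -
  interpret valued_subfield K F V by fact
  show ?thesis
  proof
    show "inverse x \<in> max_ideal V" using not_in_V[OF x_in_F x] .
    show "inverse x \<noteq> 0" using x_nz by simp
    fix z assume "z \<in> F" "z \<noteq> 0"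
    then obtain f g where "f \<in> poly_over K" "g \<in> poly_over K" "f \<noteq> 0" "g \<noteq> 0" "z = poly f x / poly g x"
      using F_iff by fastforce
    then show "\<exists>n. z / inverse x powi n \<in> unit_set V" using fraction_val_infinity[OF V x] by blast
  qed
qed

lemma val_infinity:
  assumes V: "valued_subfield K F V" and x: "x \<notin> V" and f: "f \<in> poly_over K" "f \<noteq> 0"
    and g: "g \<in> poly_over K" "g \<noteq> 0"
  shows "val V (poly f x / poly g x) = int (degree g) - int (degree f)"
  by (rule discrete_place.val_eqI[OF infinity_discrete[OF V x] fraction_val_infinity[OF V x f g]])

text \<open>In both rings the value of a fraction is the difference of the degrees, so membership
  agrees. One inclusion suffices, as the roles can be exchanged.\<close>

lemma infinity_unique:
  assumes V: "valued_subfield K F V" "x \<notin> V" and V': "valued_subfield K F V'" "x \<notin> V'"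
  shows "V \<subseteq> V'"
proof
  interpret V: discrete_place K F V "inverse x" using infinity_discrete V by blast
  interpret V': discrete_place K F V' "inverse x" using infinity_discrete V' by blast
  fix z assume z: "z \<in> V"
  show "z \<in> V'"
  proof (cases "z = 0")
    case False
    obtain f g where fg: "f \<in> poly_over K" "g \<in> poly_over K" "f \<noteq> 0" "g \<noteq> 0" "z = poly f x / poly g x"
      using F_iff V.in_L[OF z] False by fastforce
    then have "val V z = val V' z" using val_infinity[OF V] val_infinity[OF V'] by simp
    then show ?thesis using z V.in_V_iff[OF V.in_L[OF z] False] V'.in_V_iff[OF V.in_L[OF z] False] by simp
  qed (simp add: V'.V_closed)
qed

text \<open>The witness consists of the fractions whose numerator has at most the degree of the
  denominator. Together with uniqueness it gives meaning to the definite description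
  \<open>pole_place\<close>.\<close>

lemma infinity_exists: "\<exists>V. place K F V \<and> x \<notin> V"
proof -
  define V where "V = {poly f x / poly g x | f g. f \<in> poly_over K \<and> g \<in> poly_over K \<and> g \<noteq> 0 \<and> degree f \<le> degree g}"
  have VI: "poly f x / poly g x \<in> V" if "f \<in> poly_over K" "g \<in> poly_over K" "g \<noteq> 0" "degree f \<le> degree g" for f g
    using that unfolding V_def by blast
  have VE: "\<exists>f g. f \<in> poly_over K \<and> g \<in> poly_over K \<and> g \<noteq> 0 \<and> degree f \<le> degree g \<and> poly g x \<noteq> 0 \<and> z = poly f x / poly g x" if "z \<in> V" for z
    using that poly_x_eq_0 unfolding V_def by blast
  have xV: "x \<notin> V"
  proof
    assume "x \<in> V"
    then obtain f g where fg: "f \<in> poly_over K" "g \<in> poly_over K" "g \<noteq> 0" "degree f \<le> degree g" "poly g x \<noteq> 0"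
      "x = poly f x / poly g x" using VE by blast
    then have "poly ([:0,1:] * g) x = poly f x" by (simp add: field_simps)
    then have "[:0,1:] * g = f" using poly_x_inj[OF pcl(6)[OF pcl(4) fg(2)] fg(1)] by blast
    then have "degree f = Suc (degree g)" using fg(3) by auto
    then show False using fg by simp
  qed
  have "place K F V"
    unfolding place_def
  proof (intro conjI ballI impI)
    show "V \<subseteq> F" using fraction_in_F unfolding V_def by blast
    show "K \<subseteq> V" using VI[OF pcl(3) pcl(2)] by auto
    show "V \<noteq> F" using xV x_in_F by blast
    fix a assume a: "a \<in> V"
    from VE[OF a] obtain f g where fg: "f \<in> poly_over K" "g \<in> poly_over K" "g \<noteq> 0" "degree f \<le> degree g" "poly g x \<noteq> 0"
      "a = poly f x / poly g x" by blast
    show "- a \<in> V" using VI[OF pcl(7)[OF fg(1)] fg(2,3)] fg by simp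
    fix b assume b: "b \<in> V"
    from VE[OF b] obtain f' g' where fg': "f' \<in> poly_over K" "g' \<in> poly_over K" "g' \<noteq> 0" "degree f' \<le> degree g'" "poly g' x \<noteq> 0"
      "b = poly f' x / poly g' x" by blast
    have d: "degree (g * g') = degree g + degree g'" using fg fg' by (simp add: degree_mult_eq)
    have d': "degree (f * g') \<le> degree g + degree g'" "degree (f' * g) \<le> degree g + degree g'"
      "degree (f * f') \<le> degree g + degree g'"
      using fg fg' degree_mult_le[of f g'] degree_mult_le[of f' g] degree_mult_le[of f f'] by linarith+
    have "a + b = poly (f * g' + f' * g) x / poly (g * g') x"
      unfolding fg(6) fg'(6) using fg(5) fg'(5) by (simp add: field_simps)
    also have "\<dots> \<in> V" using fg fg' d d' by (intro VI pcl) (auto intro: degree_add_le)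
    finally show "a + b \<in> V" .
    have "a * b = poly (f * f') x / poly (g * g') x" using fg fg' by simp
    also have "\<dots> \<in> V" using fg fg' d d' by (intro VI pcl) auto
    finally show "a * b \<in> V" .
  next
    fix z assume "z \<in> F" "z \<noteq> 0"
    then obtain f g where fg: "f \<in> poly_over K" "g \<in> poly_over K" "f \<noteq> 0" "g \<noteq> 0" "z = poly f x / poly g x"
      using F_iff by fastforce
    then show "z \<in> V \<or> inverse z \<in> V"
      using VI[of f g] VI[of g f] by (cases "degree f \<le> degree g") auto
  qed
  then show ?thesis using xV by blast
qed

lemma pole_place: "place K F (pole_place K F x)" "x \<notin> pole_place K F x"
  and pole_placeI: "\<And>V. place K F V \<Longrightarrow> x \<notin> V \<Longrightarrow> V = pole_place K F x"
proof -
  have vs: "place K F V \<Longrightarrow> valued_subfield K F V" for V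
    using K subfield_F by unfold_locales
  have u: "V = V'" if "place K F V" "x \<notin> V" "place K F V'" "x \<notin> V'" for V V'
    using infinity_unique that vs by blast
  have "\<exists>!V. place K F V \<and> x \<notin> V" using infinity_exists u by blast
  from theI'[OF this] show p: "place K F (pole_place K F x)" "x \<notin> pole_place K F x"
    unfolding pole_place_def by auto
  show "\<And>V. place K F V \<Longrightarrow> x \<notin> V \<Longrightarrow> V = pole_place K F x" using u p by blast
qed

section \<open>Finite places and elements regular away from infinity\<close>

text \<open>\<open>V\<close> is the localization at the prime ideal of \<open>q\<close>.
  Divisibility refers to \<open>poly_over K\<close> throughout, since a prime there may factor over
  the large field.\<close>

lemma prime_place:
  assumes q: "q \<in> poly_over K" "degree q > 0"
    and prime: "\<And>f g. f \<in> poly_over K \<Longrightarrow> g \<in> poly_over K \<Longrightarrow> \<exists>h\<in>poly_over K. f * g = h * q \<Longrightarrow>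
      (\<exists>h\<in>poly_over K. f = h * q) \<or> (\<exists>h\<in>poly_over K. g = h * q)"
  defines "V \<equiv> {poly f x / poly g x | f g. f \<in> poly_over K \<and> g \<in> poly_over K \<and> \<not> (\<exists>h\<in>poly_over K. g = h * q)}"
  shows "place K F V"
proof -
  have q0: "q \<noteq> 0" using q by auto
  let ?D = "\<lambda>g. \<exists>h\<in>poly_over K. g = h * q"
  have D0: "?D 0" using pcl(1) by (intro bexI[of _ 0]) auto
  have D1: "\<not> ?D 1" using q by (metis degree_1 degree_mult_eq_0 less_numeral_extra(3) mult_zero_left mult_zero_right zero_neq_one)
  have VI: "poly f x / poly g x \<in> V" if "f \<in> poly_over K" "g \<in> poly_over K" "\<not> ?D g" for f g
    using that unfolding V_def by blast
  have VE: "\<exists>f g. f \<in> poly_over K \<and> g \<in> poly_over K \<and> \<not> ?D g \<and> poly g x \<noteq> 0 \<and> z = poly f x / poly g x" if "z \<in> V" for z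
    using that poly_x_eq_0 D0 unfolding V_def by blast
  show ?thesis
    unfolding place_def
  proof (intro conjI ballI impI)
    show "V \<subseteq> F" using fraction_in_F unfolding V_def by blast
    show "K \<subseteq> V" using VI[OF pcl(3) pcl(2) D1] by auto
    have "inverse (poly q x) \<notin> V"
    proof
      assume "inverse (poly q x) \<in> V"
      then obtain f g where fg: "f \<in> poly_over K" "g \<in> poly_over K" "\<not> ?D g" "poly g x \<noteq> 0"
        "inverse (poly q x) = poly f x / poly g x" using VE by blast
      have "poly q x \<noteq> 0" using q0 poly_x_eq_0 q by blast
      then have "poly g x = poly (f * q) x" using fg by (simp add: field_simps)
      then have "g = f * q" using poly_x_inj fg pcl(6) q by blast
      then show False using fg by blast
    qed
    moreover have "inverse (poly q x) \<in> F" using subfield_closed(6)[OF subfield_F poly_in_F] q by blast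
    ultimately show "V \<noteq> F" by blast
    fix a assume a: "a \<in> V"
    from VE[OF a] obtain f g where fg: "f \<in> poly_over K" "g \<in> poly_over K" "\<not> ?D g" "poly g x \<noteq> 0"
      "a = poly f x / poly g x" by blast
    show "- a \<in> V" using VI[OF pcl(7)[OF fg(1)] fg(2,3)] fg by simp
    fix b assume b: "b \<in> V"
    from VE[OF b] obtain f' g' where fg': "f' \<in> poly_over K" "g' \<in> poly_over K" "\<not> ?D g'" "poly g' x \<noteq> 0"
      "b = poly f' x / poly g' x" by blast
    have D: "\<not> ?D (g * g')" using prime fg fg' by blast
    have "a + b = poly (f * g' + f' * g) x / poly (g * g') x"
      unfolding fg(5) fg'(5) using fg(4) fg'(4) by (simp add: field_simps)
    also have "\<dots> \<in> V" using fg fg' D by (intro VI pcl)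
    finally show "a + b \<in> V" .
    have "a * b = poly (f * f') x / poly (g * g') x" using fg fg' by simp
    also have "\<dots> \<in> V" using fg fg' D by (intro VI pcl) auto
    finally show "a * b \<in> V" .
  next
    fix z assume z: "z \<in> F" "z \<noteq> 0"
    \<comment> \<open>A denominator of least degree shares no factor \<open>q\<close> with its
      numerator, so one of the two is not divisible by \<open>q\<close>.\<close>
    define R where "R g \<longleftrightarrow> g \<in> poly_over K \<and> g \<noteq> 0 \<and> (\<exists>f\<in>poly_over K. z = poly f x / poly g x)" for g
    have "\<exists>g. R g" using z F_iff unfolding R_def by blast
    then obtain g where g: "R g" "\<And>g'. R g' \<Longrightarrow> degree g \<le> degree g'"
      using ex_has_least_nat[of R _ degree] by blast
    then obtain f where fg: "f \<in> poly_over K" "g \<in> poly_over K" "g \<noteq> 0" "z = poly f x / poly g x"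
      unfolding R_def by blast
    have "\<not> (?D f \<and> ?D g)"
    proof
      assume "?D f \<and> ?D g"
      then obtain f' g' where *: "f' \<in> poly_over K" "f = f' * q" "g' \<in> poly_over K" "g = g' * q" by blast
      have "poly q x \<noteq> 0" using q0 poly_x_eq_0 q by blast
      then have "R g'" unfolding R_def using * fg by (auto intro!: bexI[of _ f'])
      then have "degree g \<le> degree g'" by (rule g(2))
      then show False using *(4) fg(3) q by (auto simp: degree_mult_eq)
    qed
    then show "z \<in> V \<or> inverse z \<in> V" using VI[of f g] VI[of g f] fg by auto
  qed
qed

text \<open>The denominators of \<open>z\<close> form an ideal with generator \<open>h\<close>. A
  prime \<open>q\<close> dividing \<open>h\<close> would divide every denominator, but regularity at
  the place of \<open>q\<close> supplies one that \<open>q\<close> does not divide. So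
  \<open>h\<close> is constant.\<close>

lemma regular_imp_poly:
  assumes z: "z \<in> F" and reg: "\<And>V. place K F V \<Longrightarrow> x \<in> V \<Longrightarrow> z \<in> V"
  shows "\<exists>f\<in>poly_over K. z = poly f x"
proof -
  let ?dvd = "\<lambda>q g. \<exists>h\<in>poly_over K. g = h * q"
  define I where "I = {g\<in>poly_over K. \<exists>f\<in>poly_over K. poly g x * z = poly f x}"
  have "\<exists>g\<in>I. g \<noteq> 0"
  proof -
    obtain f g where "f \<in> poly_over K" "g \<in> poly_over K" "g \<noteq> 0" "z = poly f x / poly g x" using z F_iff by blast
    then show ?thesis using poly_x_eq_0 by (intro bexI[of _ g]) (auto simp: I_def)
  qed
  moreover have "f - g \<in> I" if fg: "f \<in> I" "g \<in> I" for f g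
  proof -
    obtain f' g' where "f' \<in> poly_over K" "poly f x * z = poly f' x" "g' \<in> poly_over K" "poly g x * z = poly g' x"
      using fg by (auto simp: I_def)
    then have "poly (f - g) x * z = poly (f' - g') x" "f' - g' \<in> poly_over K"
      using pcl(8) by (auto simp: left_diff_distrib)
    then show ?thesis using fg pcl(8) unfolding I_def by blast
  qed
  moreover have "g * f \<in> I" if fg: "f \<in> I" "g \<in> poly_over K" for f g
  proof -
    obtain f' where "f' \<in> poly_over K" "poly f x * z = poly f' x" using fg by (auto simp: I_def)
    then have "poly (g * f) x * z = poly (g * f') x" "g * f' \<in> poly_over K"
      using pcl(6) fg by (auto simp: mult.assoc)
    then show ?thesis using fg pcl(6) unfolding I_def by blast
  qed
  ultimately obtain h where h: "h \<in> I" "h \<noteq> 0" "\<And>f. f \<in> I \<Longrightarrow> ?dvd h f"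
    using poly_ideal_generator[OF K, of I] by (auto simp: I_def)
  have hK: "h \<in> poly_over K" using h(1) by (simp add: I_def)
  have hd: "degree h = 0"
  proof (rule ccontr)
    assume "degree h \<noteq> 0"
    moreover have "?dvd h h" using pcl(2) by (intro bexI[of _ 1]) auto
    ultimately obtain q where q: "q \<in> poly_over K" "degree q > 0" "?dvd q h"
      and qmin: "\<And>q'. q' \<in> poly_over K \<Longrightarrow> degree q' > 0 \<Longrightarrow> ?dvd q' h \<Longrightarrow> degree q \<le> degree q'"
      using ex_has_least_nat[of "\<lambda>q. q \<in> poly_over K \<and> degree q > 0 \<and> ?dvd q h" h degree] hK by auto
    have q0: "q \<noteq> 0" using q by auto
    have trans: "?dvd a c" if "?dvd a b" "?dvd b c" for a b c
      using that pcl(6) by (metis mult.assoc)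
    \<comment> \<open>A nonconstant divisor of \<open>h\<close> of least degree is prime: a
      generator \<open>e\<close> of the ideal spanned by \<open>q\<close> and \<open>g\<close>
      divides \<open>h\<close>, so it is constant or associated to \<open>q\<close>, and the latter
      would make \<open>q\<close> divide \<open>g\<close>.\<close>
    have prime: "?dvd q f \<or> ?dvd q g" if f: "f \<in> poly_over K" and g: "g \<in> poly_over K" and fg: "?dvd q (f * g)" for f g
    proof (rule disjCI)
      assume ng: "\<not> ?dvd q g"
      define J where "J = {a * q + b * g | a b. a \<in> poly_over K \<and> b \<in> poly_over K}"
      have JI: "a * q + b * g \<in> J" if "a \<in> poly_over K" "b \<in> poly_over K" for a b
        using that by (auto simp: J_def)
      have qJ: "q \<in> J" and gJ: "g \<in> J" using JI[OF pcl(2) pcl(1)] JI[OF pcl(1) pcl(2)] by auto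
      have JK: "J \<subseteq> poly_over K" unfolding J_def using q(1) g by (auto intro!: pcl(5,6))
      have J_diff: "u - v \<in> J" if uv: "u \<in> J" "v \<in> J" for u v
      proof -
        obtain a b a' b' where *: "a \<in> poly_over K" "b \<in> poly_over K" "u = a * q + b * g"
          "a' \<in> poly_over K" "b' \<in> poly_over K" "v = a' * q + b' * g" using uv unfolding J_def by blast
        have "u - v = (a - a') * q + (b - b') * g" using * by (simp add: algebra_simps)
        then show ?thesis using JI[of "a - a'" "b - b'"] * pcl(8) by simp
      qed
      have J_mult: "w * u \<in> J" if uw: "u \<in> J" "w \<in> poly_over K" for u w
      proof -
        obtain a b where *: "a \<in> poly_over K" "b \<in> poly_over K" "u = a * q + b * g" using uw unfolding J_def by blast
        have "w * u = (w * a) * q + (w * b) * g" using * by (simp add: algebra_simps)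
        then show ?thesis using JI[of "w * a" "w * b"] * pcl(6) uw by simp
      qed
      have "\<exists>u\<in>J. u \<noteq> 0" using qJ q0 by blast
      from poly_ideal_generator[OF K JK this J_diff J_mult]
      obtain e where e: "e \<in> J" "e \<noteq> 0" "\<And>f. f \<in> J \<Longrightarrow> ?dvd e f" by blast
      have eK: "e \<in> poly_over K" using e(1) JK by blast
      have "degree e = 0"
      proof (rule ccontr)
        assume "degree e \<noteq> 0"
        then have le: "degree q \<le> degree e" using qmin[OF eK] trans[OF e(3)[OF qJ] q(3)] by simp
        obtain c where c: "c \<in> poly_over K" "q = c * e" using e(3)[OF qJ] by blast
        have "degree q = degree c + degree e" using c q0 by (auto simp: degree_mult_eq)
        then have "degree c = 0" using le by simp
        then obtain c0 where c0: "c = [:c0:]" by (rule degree_eq_zeroE)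
        have c0K: "c0 \<in> K" using c(1) poly_over_iff[OF K, of c] c0 by (metis coeff_pCons_0)
        have "c0 \<noteq> 0" using c c0 q0 by auto
        then have "e = [:inverse c0:] * q" using c c0 by simp
        moreover have "[:inverse c0:] \<in> poly_over K" using pcl(3) subfield_closed(6)[OF K c0K] by blast
        ultimately have "?dvd q e" by blast
        then show False using ng trans e(3)[OF gJ] by blast
      qed
      then obtain c0 where c0: "e = [:c0:]" by (rule degree_eq_zeroE)
      have c0K: "c0 \<in> K" using eK poly_over_iff[OF K, of e] c0 by (metis coeff_pCons_0)
      have c00: "c0 \<noteq> 0" using e c0 by auto
      obtain a b where ab: "a \<in> poly_over K" "b \<in> poly_over K" "e = a * q + b * g" using e(1) unfolding J_def by blast
      obtain w where w: "w \<in> poly_over K" "f * g = w * q" using fg by blast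
      \<comment> \<open>Bezout: multiplied by \<open>f\<close>, both summands of the combination
        \<open>e\<close> become multiples of \<open>q\<close>, and \<open>e\<close> is an invertible
        constant.\<close>
      have "f * e = (f * a + b * w) * q" unfolding ab(3) using w(2) by (simp add: algebra_simps)
      then have "f = smult (inverse c0) (f * a + b * w) * q" using c0 c00
        by (metis (no_types, lifting) left_inverse mult.right_neutral mult_smult_left mult_smult_right
            pCons_one smult_1_left smult_pCons smult_0_right mult.commute)
      moreover have "smult (inverse c0) (f * a + b * w) \<in> poly_over K"
        using f ab w subfield_closed(6)[OF K c0K] by (intro pcl)
      ultimately show "?dvd q f" by blast
    qed
    define V where "V = {poly f x / poly g x | f g. f \<in> poly_over K \<and> g \<in> poly_over K \<and> \<not> ?dvd q g}"
    have "place K F V" unfolding V_def using prime_place[OF q(1,2) prime] by blast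
    moreover have "x \<in> V"
    proof -
      have "\<not> ?dvd q 1" using q(2) q0 by (metis degree_1 degree_mult_eq_0 less_numeral_extra(3) mult_zero_left zero_neq_one)
      then show ?thesis unfolding V_def using pcl(2,4) by (intro CollectI exI[of _ "[:0,1:]"] exI[of _ 1]) auto
    qed
    ultimately have "z \<in> V" by (rule reg)
    then obtain f g where fg: "f \<in> poly_over K" "g \<in> poly_over K" "\<not> ?dvd q g" "z = poly f x / poly g x"
      unfolding V_def by blast
    have "g \<noteq> 0" using fg(3) pcl(1) by (metis mult_zero_left)
    then have "g \<in> I" using fg poly_x_eq_0 by (auto simp: I_def)
    then show False using h(3) trans q(3) fg(3) by blast
  qed
  then obtain c where c: "h = [:c:]" by (rule degree_eq_zeroE)
  have cK: "c \<in> K" using hK poly_over_iff[OF K, of h] c by (metis coeff_pCons_0)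
  obtain f where f: "f \<in> poly_over K" "poly h x * z = poly f x" using h(1) by (auto simp: I_def)
  have "z = poly (smult (inverse c) f) x" using f c h(2) by (simp add: field_simps)
  then show ?thesis using pcl(9)[OF subfield_closed(6)[OF K cK] f(1)] by blast
qed

end

section \<open>Expansions in mixed radix and evaluation at rational places\<close>

lemma sum_lessThan_mult:
  fixes f :: "nat \<Rightarrow> 'a::comm_monoid_add"
  shows "(\<Sum>v<N * d. f v) = (\<Sum>u<N. \<Sum>j<d. f (u + N * j))"
proof (induction d)
  case (Suc d)
  have "{..<N * Suc d} = {..<N * d} \<union> {N * d..<N * d + N}" by auto
  moreover have "{..<N * d} \<inter> {N * d..<N * d + N} = {}" by auto
  ultimately have "(\<Sum>v<N * Suc d. f v) = (\<Sum>v<N * d. f v) + (\<Sum>v=N * d..<N * d + N. f v)"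
    by (metis sum.union_disjoint finite_lessThan finite_atLeastLessThan)
  also have "(\<Sum>v=N * d..<N * d + N. f v) = (\<Sum>u<N. f (u + N * d))"
    using sum.shift_bounds_nat_ivl[of f 0 "N * d" N] by (simp add: atLeast0LessThan add.commute)
  finally show ?case by (simp add: Suc.IH sum.distrib)
qed simp

text \<open>The product of the radices below \<open>i\<close> contains those up to and including
  \<open>l\<close>, so the added multiple disappears modulo \<open>p l\<close> after the
  division.\<close>

lemma digit_low:
  assumes "l < i" "\<And>l. l < i \<Longrightarrow> p l > 0"
  shows "digit p (u + (\<Prod>l<i. p l) * j) l = digit p u l"
proof -
  have split: "{..<i} = {..<l} \<union> {l} \<union> {Suc l..<i}" using assms by auto
  have "(\<Prod>l<i. p l) = (\<Prod>l<l. p l) * p l * (\<Prod>l=Suc l..<i. p l)"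
    unfolding split by (subst prod.union_disjoint; auto)+
  then obtain c where c: "(\<Prod>l<i. p l) = (\<Prod>l<l. p l) * (p l * c)" by (metis mult.assoc)
  have "(\<Prod>l<l. p l) > 0" using assms by (intro prod_pos) auto
  then have "(u + (\<Prod>l<i. p l) * j) div (\<Prod>l<l. p l) = u div (\<Prod>l<l. p l) + p l * (c * j)"
    unfolding c by (simp add: mult.assoc)
  then show ?thesis by (simp add: digit_def)
qed

lemma ymon_Suc:
  assumes "u < (\<Prod>l<i. p l)" "j < p i" "\<And>l. l < i \<Longrightarrow> p l > 0"
  shows "ymon p (Suc i) y (u + (\<Prod>l<i. p l) * j) = ymon p i y u * y i ^ j"
proof -
  have "digit p (u + (\<Prod>l<i. p l) * j) i = j" using assms by (simp add: digit_def)
  moreover have "(\<Prod>l<i. y l ^ digit p (u + (\<Prod>l<i. p l) * j) l) = (\<Prod>l<i. y l ^ digit p u l)"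
    using assms by (intro prod.cong) (auto simp: digit_low)
  ultimately show ?thesis by (simp add: ymon_def)
qed

lemma sum_ymon_Suc:
  assumes "\<And>l. l < i \<Longrightarrow> p l > 0"
  shows "(\<Sum>v<(\<Prod>l<Suc i. p l). a v * ymon p (Suc i) y v)
    = (\<Sum>u<(\<Prod>l<i. p l). (\<Sum>j<p i. a (u + (\<Prod>l<i. p l) * j) * y i ^ j) * ymon p i y u)"
  unfolding prod.lessThan_Suc sum_lessThan_mult sum_distrib_right
  by (intro sum.cong refl) (use assms in \<open>simp add: ymon_Suc mult.assoc mult.commute[of "y i ^ _"]\<close>)

text \<open>The family \<open>R\<close> is arbitrary because two kinds of condition are pushed down
  the tower: integrality over one place, and regularity away from infinity with a bounded pole
  there.\<close>

lemma tower_representation: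
  assumes pos: "\<And>l. l < r \<Longrightarrow> p l > 0"
    and step: "\<And>i f. i < r \<Longrightarrow> f \<in> R i \<Longrightarrow> \<exists>a. (\<forall>j<p i. a j \<in> R (Suc i)) \<and> f = (\<Sum>j<p i. a j * y i ^ j)"
    and f: "f \<in> R 0" and i: "i \<le> r"
  shows "\<exists>a. (\<forall>u<(\<Prod>l<i. p l). a u \<in> R i) \<and> f = (\<Sum>u<(\<Prod>l<i. p l). a u * ymon p i y u)"
  using i
proof (induction i)
  case 0
  then show ?case using f by (intro exI[of _ "\<lambda>_. f"]) (simp add: ymon_def)
next
  case (Suc i)
  let ?N = "\<Prod>l<i. p l"
  obtain a where a: "\<forall>u<?N. a u \<in> R i" "f = (\<Sum>u<?N. a u * ymon p i y u)"
    using Suc by auto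
  have "\<forall>u. \<exists>b. u < ?N \<longrightarrow> (\<forall>j<p i. b j \<in> R (Suc i)) \<and> a u = (\<Sum>j<p i. b j * y i ^ j)"
    using step[of i] a(1) Suc.prems by (metis Suc_le_eq)
  then obtain b where b: "\<And>u. u < ?N \<Longrightarrow> (\<forall>j<p i. b u j \<in> R (Suc i)) \<and> a u = (\<Sum>j<p i. b u j * y i ^ j)"
    by metis
  \<comment> \<open>The new digit is the most significant one, hence the quotient by
    \<open>?N\<close>; the remainder is the old index.\<close>
  define c where "c v = b (v mod ?N) (v div ?N)" for v
  have c: "c (u + ?N * j) = b u j" if "u < ?N" for u j
  proof -
    have "?N \<noteq> 0" using that by linarith
    then have "(u + ?N * j) div ?N = j" using div_mult_self2[of ?N u j] div_less[OF that] by linarith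
    then show ?thesis using that by (simp add: c_def)
  qed
  have "(\<Sum>v<(\<Prod>l<Suc i. p l). c v * ymon p (Suc i) y v) = f"
    using Suc.prems pos unfolding a(2) by (subst sum_ymon_Suc) (auto simp: c b)
  moreover have "c v \<in> R (Suc i)" if "v < ?N * p i" for v
  proof -
    have "?N > 0" using that by (cases ?N) auto
    then show ?thesis using that b by (simp add: c_def less_mult_imp_div_less mult.commute)
  qed
  ultimately show ?case by (intro exI[of _ c]) (simp add: mult.commute)
qed

text \<open>Grouping by the lower digits makes the inner sums elements of \<open>L i\<close>. They
  vanish by induction, and then \<open>step\<close> kills their coefficients.\<close>

lemma tower_independence:
  assumes pos: "\<And>l. l < r \<Longrightarrow> p l > 0"
    and sub: "\<And>i. i \<le> r \<Longrightarrow> subfield (L i)" and incl: "\<And>i. i < r \<Longrightarrow> L (Suc i) \<subseteq> L i"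
    and y: "\<And>i. i < r \<Longrightarrow> y i \<in> L i"
    and step: "\<And>i a j. i < r \<Longrightarrow> (\<And>j. j < p i \<Longrightarrow> a j \<in> L (Suc i)) \<Longrightarrow> (\<Sum>j<p i. a j * y i ^ j) = 0
      \<Longrightarrow> j < p i \<Longrightarrow> a j = 0"
    and i: "i \<le> r" and a: "\<And>u. u < (\<Prod>l<i. p l) \<Longrightarrow> a u \<in> L i"
    and zero: "(\<Sum>u<(\<Prod>l<i. p l). a u * ymon p i y u) = 0" and v: "v < (\<Prod>l<i. p l)"
  shows "a v = 0"
  using i a zero v
proof (induction i arbitrary: a v)
  case 0
  then show ?case by (simp add: ymon_def)
next
  case (Suc i)
  let ?N = "\<Prod>l<i. p l"
  have i: "i < r" "i \<le> r" using Suc.prems by auto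
  define b where "b u = (\<Sum>j<p i. a (u + ?N * j) * y i ^ j)" for u
  have idx: "u + ?N * j < (\<Prod>l<Suc i. p l)" if "u < ?N" "j < p i" for u j
  proof -
    have "u + ?N * j < ?N * Suc j" using that by simp
    also have "\<dots> \<le> ?N * p i" using that by (intro mult_left_mono) auto
    finally show ?thesis by simp
  qed
  have bL: "b u \<in> L i" if "u < ?N" for u
    unfolding b_def using Suc.prems(2)[OF idx[OF that]] incl[OF i(1)] y[OF i(1)] sub[OF i(2)]
    by (intro subfield_sum subfield_closed(4) subfield_power) auto
  have "(\<Sum>u<?N. b u * ymon p i y u) = 0"
    unfolding b_def using Suc.prems(3) pos i by (subst (asm) sum_ymon_Suc) auto
  then have b0: "b u = 0" if "u < ?N" for u using Suc.IH[of b u] i(2) bL that by blast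
  have N: "?N > 0" using Suc.prems(4) by (cases ?N) auto
  then have v: "v mod ?N < ?N" "v div ?N < p i"
    using Suc.prems(4) by (auto simp: less_mult_imp_div_less mult.commute)
  have "a (v mod ?N + ?N * (v div ?N)) = 0"
    using step[OF i(1), of "\<lambda>j. a (v mod ?N + ?N * j)"] Suc.prems(2)[OF idx[OF v(1)]] b0[OF v(1)] v(2)
    unfolding b_def by blast
  then show ?case by simp
qed

section \<open>Residues at rational places\<close>

locale rational_valued_field = valued_subfield +
  assumes rational: "rational_place K V"
begin

text \<open>Two admissible constants differ by a constant in the maximal ideal, which must be 0
  because nonzero constants are units.\<close>

lemma eval_eqI: "c \<in> K \<Longrightarrow> z - c \<in> max_ideal V \<Longrightarrow> eval_at K V z = c"
  unfolding eval_at_def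
proof (rule the_equality)
  fix c' assume c: "c \<in> K" "z - c \<in> max_ideal V" and c': "c' \<in> K \<and> z - c' \<in> max_ideal V"
  have "c - c' \<in> max_ideal V" using max_diff[of "z - c'" "z - c"] c c' by simp
  moreover have "c - c' \<in> K" using c c' subfield_closed(7)[OF K] by blast
  ultimately have "c - c' = 0" using K_unit unit_setD(5) by blast
  then show "c' = c" by simp
qed auto

lemma eval: "z \<in> V \<Longrightarrow> eval_at K V z \<in> K" "z \<in> V \<Longrightarrow> z - eval_at K V z \<in> max_ideal V"
proof -
  assume "z \<in> V"
  then obtain c where "c \<in> K" "z - c \<in> max_ideal V" using rational unfolding rational_place_def by blast
  then show "eval_at K V z \<in> K" "z - eval_at K V z \<in> max_ideal V" using eval_eqI by auto
qed

lemma eval_const: "c \<in> K \<Longrightarrow> eval_at K V c = c"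
  by (rule eval_eqI) (auto simp: max_zero)

lemma eval_add: "z \<in> V \<Longrightarrow> w \<in> V \<Longrightarrow> eval_at K V (z + w) = eval_at K V z + eval_at K V w"
  using max_add[OF eval(2) eval(2), of z w] eval(1)
  by (intro eval_eqI subfield_closed(3)[OF K]) (auto simp: algebra_simps)

lemma eval_mult: "z \<in> V \<Longrightarrow> w \<in> V \<Longrightarrow> eval_at K V (z * w) = eval_at K V z * eval_at K V w"
proof (intro eval_eqI subfield_closed(4)[OF K])
  assume z: "z \<in> V" and w: "w \<in> V"
  have "z * w - eval_at K V z * eval_at K V w
      = (z - eval_at K V z) * w + eval_at K V z * (w - eval_at K V w)" by (simp add: algebra_simps)
  also have "\<dots> \<in> max_ideal V"
    using z w eval K_in by (intro max_add max_mult max_mult') auto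
  finally show "z * w - eval_at K V z * eval_at K V w \<in> max_ideal V" .
qed (use eval in auto)

lemma eval_sum: "(\<And>i. i \<in> I \<Longrightarrow> f i \<in> V) \<Longrightarrow> eval_at K V (sum f I) = (\<Sum>i\<in>I. eval_at K V (f i))"
  by (induction I rule: infinite_finite_induct) (auto simp: eval_const subfield_closed[OF K] eval_add V_sum)

lemma eval_prod: "(\<And>i. i \<in> I \<Longrightarrow> f i \<in> V) \<Longrightarrow> eval_at K V (prod f I) = (\<Prod>i\<in>I. eval_at K V (f i))"
  by (induction I rule: infinite_finite_induct) (auto simp: eval_const subfield_closed[OF K] eval_mult V_prod)

lemma eval_power: "z \<in> V \<Longrightarrow> eval_at K V (z ^ n) = eval_at K V z ^ n"
  by (induction n) (auto simp: eval_const subfield_closed[OF K] eval_mult V_power)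

lemma poly_in_V: "f \<in> poly_over K \<Longrightarrow> z \<in> V \<Longrightarrow> poly f z \<in> V"
  unfolding poly_altdef using poly_over_iff[OF K, of f] K_in by (intro V_sum V_closed(4) V_power) auto

lemma eval_poly: "f \<in> poly_over K \<Longrightarrow> z \<in> V \<Longrightarrow> eval_at K V (poly f z) = poly f (eval_at K V z)"
  unfolding poly_altdef using poly_over_iff[OF K, of f]
  by (subst eval_sum) (auto simp: K_in V_power V_closed(4) eval_mult eval_power eval_const)

text \<open>\<open>V\<close> is the sum of \<open>K\<close> and its maximal ideal. For nonzero
  \<open>w\<close> in that ideal \<open>inverse w\<close> is not in \<open>V\<close>, let alone in
  \<open>V'\<close>, so \<open>w\<close> is in \<open>V'\<close>. Hence distinct rational places are
  incomparable, and no discreteness is involved.\<close>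

lemma rational_maximal:
  assumes "valued_subfield K L V'" "V' \<subseteq> V" shows "V \<subseteq> V'"
proof
  interpret V': valued_subfield K L V' by fact
  fix z assume z: "z \<in> V"
  have "w \<in> V'" if "w \<in> max_ideal V" for w
    using that V'.in_V_or_inverse[of w] max_idealD(2)[OF that] assms(2) V'.V_closed(1)
    by (auto simp: max_ideal_def)
  then have "z - eval_at K V z + eval_at K V z \<in> V'"
    using eval[OF z] V'.K_in by (intro V'.V_closed(3)) auto
  then show "z \<in> V'" by simp
qed

text \<open>Since the residue field is \<open>K\<close>, the polynomial \<open>1 + (\<Prod>c\<in>K. X - c)\<close> takes the residue 1
  everywhere, so its reciprocal is regular at every rational place.\<close>
lemma eval_separator:
  assumes fin: "finite K" and z: "z \<in> L"
  defines "e \<equiv> inverse (1 + (\<Prod>c\<in>K. z - c))"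
  shows "e \<in> V" "eval_at K V e = (if z \<in> V then 1 else 0)"
proof -
  let ?q = "\<Prod>c\<in>K. z - c"
  have K1: "1 \<in> K" "0 \<in> K" using subfield_closed[OF K] by auto
  have zc: "z - c \<in> L" if "c \<in> K" for c using subfield_closed(7)[OF L z in_L[OF K_in[OF that]]] .
  have "e \<in> V \<and> eval_at K V e = (if z \<in> V then 1 else 0)"
  proof (cases "z \<in> V")
    case True
    have "?q = (z - eval_at K V z) * (\<Prod>c\<in>K - {eval_at K V z}. z - c)"
      using fin eval(1)[OF True] by (rule prod.remove)
    also have "\<dots> \<in> max_ideal V"
      using True K_in eval(2)[OF True] by (intro max_mult V_prod V_closed(6)) auto
    finally have q: "?q \<in> max_ideal V" .
    then have u: "1 + ?q \<in> unit_set V" by (intro unit_add_max unit_closed(1))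
    have eV: "e \<in> V" using unit_setD(3)[OF u] by (simp add: e_def)
    have "e - 1 = - (?q * e)" using unit_setD(2)[OF u] by (simp add: e_def field_simps)
    also have "\<dots> \<in> max_ideal V" using q eV by (intro max_minus max_mult)
    finally show ?thesis using eV eval_eqI[OF K1(1)] True by simp
  next
    case False
    have nin: "z - c \<notin> V" if "c \<in> K" for c
      using False V_closed(3)[of "z - c" c] K_in[OF that] by auto
    have m: "inverse (z - c) \<in> max_ideal V" if "c \<in> K" for c
      using not_in_V[OF zc[OF that] nin[OF that]] .
    \<comment> \<open>The factor for \<open>c = 1\<close> is split off to show that the product is
      not empty, as the maximal ideal does not contain 1.\<close>
    have "inverse ?q = inverse (z - 1) * (\<Prod>c\<in>K - {1}. inverse (z - c))"
      unfolding prod_inversef[symmetric] using prod.remove[OF fin K1(1)] by (simp add: o_def)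
    also have "\<dots> \<in> max_ideal V"
      using m K1 max_idealD(1) by (intro max_mult V_prod) auto
    finally have iq: "inverse ?q \<in> max_ideal V" .
    have q0: "?q \<noteq> 0" using nin[of z] V_closed(1) fin by (auto simp: prod_zero_iff)
    have "?q \<notin> V" using inverse_max_ideal[OF iq] q0 by simp
    then have n: "1 + ?q \<notin> V" using V_closed(6)[of "1 + ?q" 1] V_closed(2) by auto
    have "1 + ?q \<in> L"
    proof (rule subfield_closed(3)[OF L subfield_closed(2)[OF L]])
      show "?q \<in> L" using subfield_closed(6)[OF L max_idealD(2)[OF iq]] by simp
    qed
    then have e: "e \<in> max_ideal V" unfolding e_def using not_in_V n by blast
    then show ?thesis using eval_eqI[OF K1(2), of e] False max_idealD(1) by simp
  qed
  then show "e \<in> V" "eval_at K V e = (if z \<in> V then 1 else 0)" by auto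
qed

end

text \<open>For each \<open>i\<close> other than \<open>l\<close> some \<open>z i\<close> is regular
  at \<open>V l\<close> but not at \<open>V i\<close>. Its separator has residue 0 or 1 everywhere,
  namely 1 at \<open>V l\<close> and 0 at \<open>V i\<close>; the product of the separators is the
  required element.\<close>

lemma rational_places_crt:
  assumes fin: "finite K" and I: "finite I"
    and V: "\<And>i. i \<in> I \<Longrightarrow> rational_valued_field K L (V i)" and inj: "inj_on V I" and l: "l \<in> I"
  shows "\<exists>e. \<forall>i\<in>I. e \<in> V i \<and> eval_at K (V i) e = (if i = l then 1 else 0)"
proof -
  have "\<exists>z\<in>V l. z \<notin> V i" if i: "i \<in> I - {l}" for i
  proof (rule ccontr)
    interpret Vi: rational_valued_field K L "V i" using V i by blast
    interpret Vl: rational_valued_field K L "V l" using V l by blast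
    assume "\<not> ?thesis"
    then have "V l \<subseteq> V i" by blast
    moreover from this have "V i \<subseteq> V l" by (rule Vi.rational_maximal[OF Vl.valued_subfield_axioms])
    ultimately have "V i = V l" by blast
    then show False using inj i l by (auto dest: inj_onD)
  qed
  then obtain z where z: "\<And>i. i \<in> I - {l} \<Longrightarrow> z i \<in> V l \<and> z i \<notin> V i" by metis
  have zL: "z i \<in> L" if "i \<in> I - {l}" for i
    using z[OF that] valued_subfield.in_L rational_valued_field.axioms(1)[OF V[OF l]] by blast
  define e where "e i = inverse (1 + (\<Prod>c\<in>K. z i - c))" for i
  show ?thesis
  proof (intro exI[of _ "\<Prod>i\<in>I-{l}. e i"] ballI conjI)
    fix j assume j: "j \<in> I"
    interpret Vj: rational_valued_field K L "V j" using V j by blast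
    have e: "e i \<in> V j" "eval_at K (V j) (e i) = (if z i \<in> V j then 1 else 0)" if "i \<in> I - {l}" for i
      using Vj.eval_separator[OF fin zL[OF that]] by (auto simp: e_def)
    show "(\<Prod>i\<in>I-{l}. e i) \<in> V j" using e by (intro Vj.V_prod)
    have "eval_at K (V j) (\<Prod>i\<in>I-{l}. e i) = (\<Prod>i\<in>I-{l}. if z i \<in> V j then 1 else 0)"
      using e by (subst Vj.eval_prod) (auto intro!: prod.cong)
    also have "\<dots> = (if j = l then 1 else 0)"
    proof (cases "j = l")
      case True
      then show ?thesis using z by (auto intro!: prod.neutral)
    next
      case False
      then show ?thesis using z[of j] j I by (auto intro!: prod_zero)
    qed
    finally show "eval_at K (V j) (\<Prod>i\<in>I-{l}. e i) = (if j = l then 1 else 0)" .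
  qed
qed

section \<open>Towers totally ramified at infinity\<close>

lemma prod_eq_imp_eq:
  fixes e p :: "'i \<Rightarrow> int"
  assumes I: "finite I" and le: "\<And>i. i \<in> I \<Longrightarrow> 1 \<le> e i" "\<And>i. i \<in> I \<Longrightarrow> e i \<le> p i"
    and eq: "prod e I = prod p I" and i: "i \<in> I"
  shows "e i = p i"
proof (rule ccontr)
  assume "e i \<noteq> p i"
  then have lt: "e i < p i" using le(2)[OF i] by simp
  have pos: "prod e (I - {i}) > 0" using le(1) by (intro prod_pos) force
  have "prod e I = e i * prod e (I - {i})" by (rule prod.remove[OF I i])
  also have "\<dots> < p i * prod e (I - {i})" using lt pos by simp
  also have "\<dots> \<le> p i * prod p (I - {i})"
    using le(1,2) lt le(1)[OF i] by (intro mult_left_mono prod_mono) (auto intro: order.trans[OF zero_le_one])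
  also have "\<dots> = prod p I" by (rule prod.remove[OF I i, symmetric])
  finally show False using eq by simp
qed

text \<open>All blocks have length \<open>m\<close>, so the concatenation can be cut back into
  them.\<close>

lemma ev_code_eq_iff:
  "ev_code K Pl m n f = ev_code K Pl m n g \<longleftrightarrow>
    (\<forall>j<n. \<forall>i<m. eval_at K (Pl i j) f = eval_at K (Pl i j) g)"
proof
  assume eq: "ev_code K Pl m n f = ev_code K Pl m n g"
  have "map (\<lambda>j. map (\<lambda>i. eval_at K (Pl i j) f) [0..<m]) [0..<n]
      = map (\<lambda>j. map (\<lambda>i. eval_at K (Pl i j) g) [0..<m]) [0..<n]"
    using eq unfolding ev_code_def by (rule concat_injective) (auto simp: set_zip)
  then show "\<forall>j<n. \<forall>i<m. eval_at K (Pl i j) f = eval_at K (Pl i j) g" by simp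
next
  assume "\<forall>j<n. \<forall>i<m. eval_at K (Pl i j) f = eval_at K (Pl i j) g"
  then show "ev_code K Pl m n f = ev_code K Pl m n g"
    unfolding ev_code_def by (intro arg_cong[where f = concat] map_cong refl) auto
qed

locale infinity_tower = rational_field K x for K :: "'e::field set" and x +
  fixes m r :: nat and p :: "nat \<Rightarrow> nat" and Et :: "nat \<Rightarrow> 'e set"
  assumes mprod: "m = (\<Prod>i<r. p i)"
    and ram: "totally_ramified K F UNIV (pole_place K F x) m"
    and Et0: "Et 0 = UNIV" and Etr: "Et r = F"
    and Et_step: "i < r \<Longrightarrow> ext_degree_is (Et (Suc i)) (Et i) (p i)"
begin

abbreviation "Pinf \<equiv> pole_place K F x"
abbreviation "PinfE \<equiv> \<lambda>i. place_above K (Et i) Pinf F"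

lemma Et_subfield: "i \<le> r \<Longrightarrow> subfield (Et i)"
  using Et_step[of i] Etr subfield_F by (cases "i = r") (auto simp: ext_degree_is_def)

lemma Et_Suc: "i < r \<Longrightarrow> Et (Suc i) \<subseteq> Et i"
  using Et_step by (auto simp: ext_degree_is_def)

lemma F_sub_Et: "i \<le> r \<Longrightarrow> F \<subseteq> Et i"
proof (induction rule: inc_induct)
  case (step i)
  then show ?case using Et_Suc by blast
qed (simp add: Etr)

lemma K_sub_Et: "i \<le> r \<Longrightarrow> K \<subseteq> Et i"
  using F_sub_Et K_sub_F by blast

lemma p_pos: "i < r \<Longrightarrow> p i > 0"
proof (rule ccontr)
  assume i: "i < r" "\<not> p i > 0"
  then have "\<forall>z\<in>Et i. z = 0" using Et_step[of i] by (auto simp: ext_degree_is_def)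
  then show False using subfield_closed(2)[OF Et_subfield[of i]] i by (metis less_imp_le one_neq_zero)
qed

lemma m_pos: "m > 0"
  unfolding mprod by (intro prod_pos) (use p_pos in auto)

lemma placeI: "i \<le> r \<Longrightarrow> place K (Et i) V \<Longrightarrow> valued_subfield K (Et i) V"
  using K Et_subfield by unfold_locales

lemma place_UNIV: "place K UNIV V \<Longrightarrow> valued_subfield K UNIV V"
  using placeI[of 0 V] Et0 by simp

lemma place_F: "place K F V \<Longrightarrow> valued_subfield K F V"
  using placeI[of r V] Etr by simp

lemma restrict_Et:
  assumes "place K UNIV V" "V \<inter> F \<noteq> F" "i \<le> r" shows "place K (Et i) (V \<inter> Et i)"
proof -
  have "V \<inter> Et i \<noteq> Et i" using assms F_sub_Et[of i] by blast
  then show ?thesis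
    using valued_subfield.restrict[OF place_UNIV[OF assms(1)] Et_subfield K_sub_Et] assms
    by (auto simp: valued_subfield_def)
qed

lemma restrict_Et_Suc:
  assumes "place K (Et i) V" "V \<inter> F \<noteq> F" "i < r" shows "place K (Et (Suc i)) (V \<inter> Et (Suc i))"
proof -
  have "V \<inter> Et (Suc i) \<noteq> Et (Suc i)" using assms F_sub_Et[of "Suc i"] by auto
  then show ?thesis
    using valued_subfield.restrict[OF placeI[OF _ assms(1)] Et_subfield K_sub_Et Et_Suc] assms
    by (auto simp: valued_subfield_def)
qed

lemma place_ne: "place K F V \<Longrightarrow> V \<noteq> F"
  by (simp add: place_def)

text \<open>The rings \<open>PinfE i\<close> are definite descriptions, meaningless before
  uniqueness is known. An arbitrary place above \<open>Pinf\<close> is therefore fixed and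
  intersected with each level, and identified with \<open>PinfE\<close> only afterwards.\<close>

definition "Qinf = (SOME Q. place K UNIV Q \<and> Q \<inter> F = Pinf)"

definition "Vinf i = Qinf \<inter> Et i"

lemma Qinf: "place K UNIV Qinf" "Qinf \<inter> F = Pinf" "ram_index Qinf Pinf = int m"
proof -
  have "\<exists>Q. place K UNIV Q \<and> Q \<inter> F = Pinf" using ram by (simp add: totally_ramified_def)
  from someI_ex[OF this] show "place K UNIV Qinf" "Qinf \<inter> F = Pinf" by (auto simp: Qinf_def)
  then show "ram_index Qinf Pinf = int m" using ram by (simp add: totally_ramified_def)
qed

lemma Vinf_0: "Vinf 0 = Qinf" and Vinf_r: "Vinf r = Pinf"
  using Qinf Et0 Etr by (auto simp: Vinf_def)

lemma Vinf_Suc: "i < r \<Longrightarrow> Vinf i \<inter> Et (Suc i) = Vinf (Suc i)"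
  using Et_Suc by (auto simp: Vinf_def)

lemma Vinf_F: "i \<le> r \<Longrightarrow> Vinf i \<inter> F = Pinf"
  using F_sub_Et Qinf by (auto simp: Vinf_def)

lemma Vinf_place: "i \<le> r \<Longrightarrow> place K (Et i) (Vinf i)"
  unfolding Vinf_def using restrict_Et[OF Qinf(1)] Qinf(2) place_ne[OF pole_place(1)] by auto

lemma Pinf_discrete: "discrete_place K F Pinf (inverse x)"
  using infinity_discrete[OF place_F[OF pole_place(1)] pole_place(2)] .

lemma Vinf_extension:
  assumes "i < r" "discrete_place K (Et (Suc i)) (Vinf (Suc i)) s"
  shows "discrete_extension K (Et (Suc i)) (Vinf (Suc i)) s (Et i) (Vinf i) (p i)"
proof -
  have i: "i \<le> r" using assms by simp
  show ?thesis
    using assms(2) placeI[OF i Vinf_place[OF i]] Et_Suc[OF assms(1)] Vinf_Suc[OF assms(1)] Et_step[OF assms(1)]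
    by (simp add: discrete_extension_def discrete_extension_axioms_def)
qed

text \<open>Decreasing \<open>i\<close> means climbing from the rational function field, where
  \<open>inverse x\<close> is the uniformizer, one finite extension at a time.\<close>

lemma Vinf_discrete: "i \<le> r \<Longrightarrow> \<exists>s. discrete_place K (Et i) (Vinf i) s"
proof (induction rule: inc_induct)
  case base
  then show ?case using Pinf_discrete Etr Vinf_r by auto
next
  case (step i)
  then show ?case using discrete_extension.discrete[OF Vinf_extension] by blast
qed

definition "sinf i = (SOME s. discrete_place K (Et i) (Vinf i) s)"

lemma sinf: "i \<le> r \<Longrightarrow> discrete_place K (Et i) (Vinf i) (sinf i)"
  unfolding sinf_def using someI_ex[OF Vinf_discrete] .

text \<open>Ramification indices multiply along the tower. The index of the step at \<open>l\<close>
  is the value of the lower uniformizer \<open>sinf (Suc l)\<close> at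
  \<open>Vinf l\<close>.\<close>

lemma val_Qinf:
  assumes "i \<le> r" "a \<in> Et i" "a \<noteq> 0"
  shows "val Qinf a = (\<Prod>l<i. val (Vinf l) (sinf (Suc l))) * val (Vinf i) a"
  using assms
proof (induction i)
  case (Suc i)
  then have "i < r" by simp
  have "val (Vinf i) a = val (Vinf i) (sinf (Suc i)) * val (Vinf (Suc i)) a"
    using discrete_extension.ramification(3)[OF Vinf_extension[OF \<open>i < r\<close> sinf] sinf] Suc.prems by auto
  then show ?case using Suc Et_Suc[OF \<open>i < r\<close>] by auto
qed (simp add: Vinf_0)

text \<open>The ramification index of a step is at most its degree, and the product of the indices is the
  product of the degrees.\<close>
lemma step_ramification: "i < r \<Longrightarrow> val (Vinf i) (sinf (Suc i)) = int (p i)"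
proof -
  let ?e = "\<lambda>i. val (Vinf i) (sinf (Suc i))"
  assume i: "i < r"
  interpret I: discrete_place K F Pinf "inverse x" by (rule Pinf_discrete)
  \<comment> \<open>The uniformizer chosen inside \<open>ram_index\<close>; it may differ from
    \<open>inverse x\<close>, but only by a unit.\<close>
  define t where "t = (SOME t. uniformizer Pinf t)"
  have t: "uniformizer Pinf t" unfolding t_def using someI[of "uniformizer Pinf"] I.uniformizer_s by blast
  then have tF: "t \<in> F" unfolding uniformizer_def using I.max_idealD(2) by blast
  have u: "t / inverse x \<in> unit_set Pinf" using I.uniformizer_quotient[OF t] .
  then have t0: "t \<noteq> 0" using I.unit_setD(2) by fastforce
  have "val Pinf t = 1" using I.val_eqI[of t 1] u by simp
  moreover have "val Qinf t = int m" using Qinf(3) by (simp add: ram_index_def t_def)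
  ultimately have "prod ?e {..<r} = int m"
    using val_Qinf[of r t] tF t0 Etr Vinf_r by simp
  then have "prod ?e {..<r} = (\<Prod>i<r. int (p i))" by (simp add: mprod)
  moreover have "1 \<le> ?e j" "?e j \<le> int (p j)" if "j \<in> {..<r}" for j
    using discrete_extension.ramification(1,2)[OF Vinf_extension[OF _ sinf] sinf, of j] that by auto
  ultimately show "?e i = int (p i)" using prod_eq_imp_eq[of "{..<r}" ?e "\<lambda>i. int (p i)" i] i by blast
qed

lemma Vinf_totally_ramified:
  "i < r \<Longrightarrow> totally_ramified_extension K (Et (Suc i)) (Vinf (Suc i)) (sinf (Suc i)) (Et i) (Vinf i) (p i) (sinf i)"
  using Vinf_extension[OF _ sinf] sinf[of i] step_ramification
  by (simp add: totally_ramified_extension_def totally_ramified_extension_axioms_def)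

text \<open>The restriction of \<open>V\<close> to the next lower field is known by induction, and a
  totally ramified step leaves room for one place above it.\<close>

lemma Vinf_unique:
  assumes "i \<le> r" "place K (Et i) V" "V \<inter> F = Pinf"
  shows "V = Vinf i"
  using assms
proof (induction arbitrary: V rule: inc_induct)
  case base
  then show ?case using Etr Vinf_r by (auto simp: place_def)
next
  case (step i)
  have "place K (Et (Suc i)) (V \<inter> Et (Suc i))"
    using restrict_Et_Suc step place_ne[OF pole_place(1)] by auto
  moreover have "V \<inter> Et (Suc i) \<inter> F = Pinf" using step F_sub_Et[of "Suc i"] by auto
  ultimately have "V \<inter> Et (Suc i) = Vinf (Suc i)" using step.IH by blast
  then show ?case
    using totally_ramified_extension.place_above_unique[OF Vinf_totally_ramified] placeI step by auto
qed

lemma PinfE_eq: "i \<le> r \<Longrightarrow> PinfE i = Vinf i"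
  unfolding place_above_def using Vinf_place Vinf_F Vinf_unique by (intro the_equality) auto

end

section \<open>Expansions in the monomials and the two codes\<close>

locale integral_tower = infinity_tower +
  fixes y :: "nat \<Rightarrow> 'a"
  assumes y_in: "i < r \<Longrightarrow> y i \<in> Et i" and y_pole: "i < r \<Longrightarrow> y i \<notin> Vinf i"
    and y_reg: "i < r \<Longrightarrow> place K (Et i) V \<Longrightarrow> V \<noteq> Vinf i \<Longrightarrow> y i \<in> V"
    and y_coprime: "i < r \<Longrightarrow> coprime (val (Vinf i) (y i)) (int (p i))"
    and integral_basis: "i < r \<Longrightarrow> place K (Et (Suc i)) Q \<Longrightarrow> Q \<noteq> Vinf (Suc i) \<Longrightarrow>
      int_closure K (Et i) (Et (Suc i)) Q = {\<Sum>j<p i. a j * y i ^ j | a. \<forall>j<p i. a j \<in> Q}"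
begin

lemma y_nz: "i < r \<Longrightarrow> y i \<noteq> 0"
  using y_pole valued_subfield.V_closed(1)[OF placeI[OF _ Vinf_place]] by (metis less_imp_le)

lemma y_val: "i < r \<Longrightarrow> val (Vinf i) (y i) \<le> 0"
  using discrete_place.in_V_iff[OF sinf y_in y_nz] y_pole by (metis less_imp_le linorder_linear)

lemma step_unique:
  assumes "i < r" "\<And>j. j < p i \<Longrightarrow> a j \<in> Et (Suc i)" "(\<Sum>j<p i. a j * y i ^ j) = 0" "j < p i"
  shows "a j = 0"
proof -
  interpret T: totally_ramified_extension K "Et (Suc i)" "Vinf (Suc i)" "sinf (Suc i)" "Et i" "Vinf i" "p i" "sinf i"
    using Vinf_totally_ramified assms by blast
  show ?thesis
    using T.power_coeffs_unique[OF y_in y_nz y_coprime, OF assms(1,1,1), of a "\<lambda>_. 0" j] assms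
      subfield_closed(1)[OF T.base.L] by simp
qed

lemma ymon_independent:
  assumes "\<And>u. u < m \<Longrightarrow> a u \<in> F" "(\<Sum>u<m. a u * ymon p r y u) = 0" "u < m"
  shows "a u = 0"
  using tower_independence[of r p Et y r a u] p_pos Et_subfield Et_Suc y_in step_unique assms
  unfolding Etr mprod by blast

text \<open>\<open>PP\<close> stays general, as it will be the places over one \<open>P\<close> or
  all places other than infinity. It must be nonempty, since each member contributes a
  representation and without one there is nothing to start from.\<close>

lemma step_coeffs:
  assumes i: "i < r" and z: "z \<in> Et i" and ne: "PP \<noteq> {}"
    and PP: "\<And>R. R \<in> PP \<Longrightarrow> place K (Et (Suc i)) R \<and> R \<noteq> Vinf (Suc i)"
    and reg: "\<And>V. place K (Et i) V \<Longrightarrow> V \<inter> Et (Suc i) \<in> PP \<Longrightarrow> z \<in> V"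
  shows "\<exists>a. (\<forall>j<p i. a j \<in> Et (Suc i) \<and> (\<forall>R\<in>PP. a j \<in> R)) \<and> z = (\<Sum>j<p i. a j * y i ^ j)"
proof -
  interpret T: totally_ramified_extension K "Et (Suc i)" "Vinf (Suc i)" "sinf (Suc i)" "Et i" "Vinf i" "p i" "sinf i"
    using Vinf_totally_ramified i by blast
  have "z \<in> {\<Sum>j<p i. a j * y i ^ j | a. \<forall>j<p i. a j \<in> R}" if R: "R \<in> PP" for R
  proof -
    have "z \<in> int_closure K (Et i) (Et (Suc i)) R" using z reg R by (auto simp: int_closure_def)
    then show ?thesis using integral_basis[OF i] PP[OF R] by blast
  qed
  then show ?thesis
    using T.common_coeffs[OF y_in y_nz y_coprime, OF i i i ne, of z] PP by (auto simp: place_def)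
qed

text \<open>The condition pushed down is regularity at all places over \<open>P\<close>; on the
  bottom level this means membership in \<open>P\<close>. The place \<open>Q\<close> guarantees that
  every level has a place over \<open>P\<close>.\<close>

lemma integral_over_place:
  assumes P: "place K F P" "P \<noteq> Pinf" and Q: "place K UNIV Q" "Q \<inter> F = P"
    and z: "\<And>V. place K UNIV V \<Longrightarrow> V \<inter> F = P \<Longrightarrow> z \<in> V"
  shows "\<exists>a. (\<forall>u<m. a u \<in> P) \<and> z = (\<Sum>u<m. a u * ymon p r y u)"
proof -
  define R where "R i = {z\<in>Et i. \<forall>V. place K (Et i) V \<and> V \<inter> F = P \<longrightarrow> z \<in> V}" for i
  have zR: "z \<in> R 0" using z Et0 by (auto simp: R_def)
  have step: "\<exists>a. (\<forall>j<p i. a j \<in> R (Suc i)) \<and> f = (\<Sum>j<p i. a j * y i ^ j)"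
    if i: "i < r" and f: "f \<in> R i" for i f
  proof -
    define PP where "PP = {V. place K (Et (Suc i)) V \<and> V \<inter> F = P}"
    have F: "F \<subseteq> Et (Suc i)" using F_sub_Et i by simp
    have "Q \<inter> Et (Suc i) \<in> PP"
      using restrict_Et[OF Q(1), of "Suc i"] place_ne[OF P(1)] i Q(2) F by (auto simp: PP_def)
    then have ne: "PP \<noteq> {}" by blast
    have PPp: "place K (Et (Suc i)) V \<and> V \<noteq> Vinf (Suc i)" if "V \<in> PP" for V
      using that Vinf_F[of "Suc i"] i P by (auto simp: PP_def)
    have reg: "f \<in> V" if "place K (Et i) V" "V \<inter> Et (Suc i) \<in> PP" for V
    proof -
      have "V \<inter> F = P" using that F by (auto simp: PP_def)
      then show ?thesis using that f by (auto simp: R_def)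
    qed
    have fE: "f \<in> Et i" using f by (simp add: R_def)
    obtain a where "\<forall>j<p i. a j \<in> Et (Suc i) \<and> (\<forall>V\<in>PP. a j \<in> V)" "f = (\<Sum>j<p i. a j * y i ^ j)"
      using step_coeffs[OF i fE ne PPp reg] by blast
    then show ?thesis by (intro exI[of _ a]) (auto simp: R_def PP_def)
  qed
  have "\<exists>a. (\<forall>u<(\<Prod>l<r. p l). a u \<in> R r) \<and> z = (\<Sum>u<(\<Prod>l<r. p l). a u * ymon p r y u)"
    by (rule tower_representation[where R = R])
      (rule p_pos, assumption, rule step, assumption, assumption, rule zR, rule order_refl)
  then obtain a where a: "\<forall>u<m. a u \<in> R r" "z = (\<Sum>u<m. a u * ymon p r y u)"
    unfolding mprod[symmetric] by blast
  have "R r \<subseteq> P"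
  proof
    fix z assume "z \<in> R r"
    moreover have "P \<inter> F = P" using P by (auto simp: place_def)
    ultimately show "z \<in> P" using P Etr by (auto simp: R_def)
  qed
  then show ?thesis using a by blast
qed

text \<open>On the bottom level, regularity away from infinity gives a polynomial, and the pole
  order there is its degree. The place \<open>Q\<close> only certifies that each level has a place
  other than infinity.\<close>

lemma RR_representation:
  assumes k: "k \<ge> 1" and PQ: "place K UNIV Q" "place K F (Q \<inter> F)" "Q \<inter> F \<noteq> Pinf"
    and f: "f \<in> RR_space K ((k - 1) * m) (PinfE 0)"
  shows "\<exists>a. (\<forall>u<m. a u \<in> poly_over K \<and> degree (a u) < k) \<and> f = (\<Sum>u<m. poly (a u) x * ymon p r y u)"
proof -
  \<comment> \<open>The pole order allowed on level \<open>i\<close>: it starts as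
    \<open>(k - 1) * m\<close>, is divided by \<open>p i\<close> in each step and ends as
    \<open>k - 1\<close>.\<close>
  define M where "M i = int (k - 1) * (\<Prod>l=i..<r. int (p l))" for i
  define R where "R i = {z\<in>Et i. (\<forall>V. place K (Et i) V \<and> V \<noteq> Vinf i \<longrightarrow> z \<in> V) \<and>
      (z \<noteq> 0 \<longrightarrow> - M i \<le> val (Vinf i) z)}" for i
  have "M 0 = int ((k - 1) * m)" by (simp add: M_def mprod atLeast0LessThan)
  then have fR: "f \<in> R 0"
    using f valued_subfield.V_closed(1)[OF place_UNIV] PinfE_eq[of 0] unfolding RR_space_def R_def Et0
    by auto
  have step: "\<exists>a. (\<forall>j<p i. a j \<in> R (Suc i)) \<and> z = (\<Sum>j<p i. a j * y i ^ j)"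
    if i: "i < r" and z: "z \<in> R i" for i z
  proof -
    define PP where "PP = {V. place K (Et (Suc i)) V \<and> V \<noteq> Vinf (Suc i)}"
    have F: "F \<subseteq> Et (Suc i)" using F_sub_Et i by simp
    have "Q \<inter> Et (Suc i) \<inter> F \<noteq> Pinf" using PQ(3) F by (metis Int_absorb1 Int_assoc)
    then have "Q \<inter> Et (Suc i) \<in> PP"
      using restrict_Et[OF PQ(1) place_ne[OF PQ(2)], of "Suc i"] i Vinf_F[of "Suc i"] by (auto simp: PP_def)
    then have ne: "PP \<noteq> {}" by blast
    have PPp: "place K (Et (Suc i)) V \<and> V \<noteq> Vinf (Suc i)" if "V \<in> PP" for V
      using that by (simp add: PP_def)
    have reg: "z \<in> V" if "place K (Et i) V" "V \<inter> Et (Suc i) \<in> PP" for V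
    proof -
      have "V \<noteq> Vinf i" using that Vinf_Suc[OF i] by (auto simp: PP_def)
      then show ?thesis using that z by (auto simp: R_def)
    qed
    have zE: "z \<in> Et i" using z by (simp add: R_def)
    obtain a where a: "\<forall>j<p i. a j \<in> Et (Suc i) \<and> (\<forall>V\<in>PP. a j \<in> V)" "z = (\<Sum>j<p i. a j * y i ^ j)"
      using step_coeffs[OF i zE ne PPp reg] by blast
    interpret T: totally_ramified_extension K "Et (Suc i)" "Vinf (Suc i)" "sinf (Suc i)" "Et i" "Vinf i" "p i" "sinf i"
      using Vinf_totally_ramified i by blast
    have "M i = M (Suc i) * int (p i)" using i by (simp add: M_def prod.atLeast_Suc_lessThan)
    then have "- M (Suc i) \<le> val (Vinf (Suc i)) (a j)" if "j < p i" "a j \<noteq> 0" for j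
      using T.coeff_val_ge[OF y_in y_nz y_coprime y_val, OF i i i i, of a z "M (Suc i)" j] a z that
      by (auto simp: R_def)
    then show ?thesis using a by (intro exI[of _ a]) (auto simp: R_def PP_def)
  qed
  have "\<exists>a. (\<forall>u<(\<Prod>l<r. p l). a u \<in> R r) \<and> f = (\<Sum>u<(\<Prod>l<r. p l). a u * ymon p r y u)"
    by (rule tower_representation[where R = R])
      (rule p_pos, assumption, rule step, assumption, assumption, rule fR, rule order_refl)
  then obtain b where b: "\<forall>u<m. b u \<in> R r" "f = (\<Sum>u<m. b u * ymon p r y u)"
    unfolding mprod[symmetric] by blast
  have "\<exists>a. a \<in> poly_over K \<and> degree a < k \<and> z = poly a x" if z: "z \<in> R r" for z
  proof -
    have "z \<in> F" "\<And>V. place K F V \<Longrightarrow> x \<in> V \<Longrightarrow> z \<in> V"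
      using z pole_place(2) Vinf_r Etr by (auto simp: R_def)
    then obtain a where a: "a \<in> poly_over K" "z = poly a x" using regular_imp_poly by blast
    have "degree a < k"
    proof (cases "a = 0")
      case False
      then have "z \<noteq> 0" using a poly_x_eq_0 by simp
      then have "- int (k - 1) \<le> val Pinf z" using z Vinf_r by (simp add: R_def M_def)
      moreover have "val Pinf z = - int (degree a)"
        using val_infinity[OF place_F[OF pole_place(1)] pole_place(2) a(1) False pcl(2)] a by simp
      ultimately show ?thesis using k by linarith
    qed (use k in simp)
    then show ?thesis using a by blast
  qed
  then obtain h where h: "\<And>z. z \<in> R r \<Longrightarrow> h z \<in> poly_over K \<and> degree (h z) < k \<and> z = poly (h z) x" by metis
  have "f = (\<Sum>u<m. poly (h (b u)) x * ymon p r y u)"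
    unfolding b(2) using b(1) h by (intro sum.cong refl) auto
  then show ?thesis using b(1) h by (intro exI[of _ "\<lambda>u. h (b u)"]) auto
qed

lemma coeff_rep:
  assumes k: "k \<ge> 1" and PQ: "place K UNIV Q" "place K F (Q \<inter> F)" "Q \<inter> F \<noteq> Pinf"
    and f: "f \<in> RR_space K ((k - 1) * m) (PinfE 0)"
  defines "fs \<equiv> coeff_rep K x p r y m k f"
  shows "length fs = m" "u < m \<Longrightarrow> fs ! u \<in> poly_over K" "f = (\<Sum>u<m. poly (fs ! u) x * ymon p r y u)"
proof -
  define S where "S fs \<longleftrightarrow> length fs = m \<and> (\<forall>g\<in>set fs. set (coeffs g) \<subseteq> K \<and> degree g < k) \<and>
      f = (\<Sum>u<m. poly (fs ! u) x * ymon p r y u)" for fs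
  obtain a where a: "\<forall>u<m. a u \<in> poly_over K \<and> degree (a u) < k" "f = (\<Sum>u<m. poly (a u) x * ymon p r y u)"
    using RR_representation[OF k PQ f] by blast
  have ex: "S (map a [0..<m])" using a by (auto simp: S_def poly_over_def)
  have "gs = hs" if S: "S gs" "S hs" for gs hs
  proof (rule nth_equalityI)
    show "length gs = length hs" using S by (simp add: S_def)
    fix u assume "u < length gs"
    then have u: "u < m" using S by (simp add: S_def)
    have p: "gs ! v \<in> poly_over K" "hs ! v \<in> poly_over K" if "v < m" for v
      using S that by (auto simp: S_def poly_over_def)
    have "(\<Sum>u<m. (poly (gs ! u) x - poly (hs ! u) x) * ymon p r y u) = 0"
      using S by (simp add: S_def left_diff_distrib sum_subtractf)
    moreover have "poly (gs ! v) x - poly (hs ! v) x \<in> F" if "v < m" for v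
      using p[OF that] by (intro subfield_closed(7)[OF subfield_F] poly_in_F)
    ultimately have "poly (gs ! u) x - poly (hs ! u) x = 0"
      using ymon_independent[of "\<lambda>u. poly (gs ! u) x - poly (hs ! u) x"] u by blast
    then show "gs ! u = hs ! u" using poly_x_inj p u by auto
  qed
  then have "\<exists>!fs. S fs" using ex by blast
  moreover have "fs = (THE fs. S fs)" by (simp only: fs_def coeff_rep_def S_def)
  ultimately have "S fs" using theI'[of S] by simp
  then show "length fs = m" "u < m \<Longrightarrow> fs ! u \<in> poly_over K" "f = (\<Sum>u<m. poly (fs ! u) x * ymon p r y u)"
    by (auto simp: S_def poly_over_def)
qed

lemma ymon_regular:
  assumes "place K UNIV V" "V \<inter> F \<noteq> F" "V \<inter> F \<noteq> Pinf" shows "ymon p r y u \<in> V"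
  unfolding ymon_def
proof (intro valued_subfield.V_prod[OF place_UNIV[OF assms(1)]] valued_subfield.V_power[OF place_UNIV[OF assms(1)]])
  fix i assume "i \<in> {..<r}"
  then have i: "i < r" "i \<le> r" by auto
  have "V \<inter> Et i \<inter> F = V \<inter> F" using F_sub_Et[OF i(2)] by blast
  then have "V \<inter> Et i \<noteq> Vinf i" using Vinf_F[OF i(2)] assms(3) by metis
  then show "y i \<in> V" using y_reg[OF i(1) restrict_Et[OF assms(1,2) i(2)]] by blast
qed

lemma x_regular: "place K F V \<Longrightarrow> V \<noteq> Pinf \<Longrightarrow> x \<in> V"
  using pole_placeI by blast

text \<open>At a completely split place the evaluations of the monomials form a square matrix over \<open>K\<close>;
  it has a right inverse because the places above can be separated by integral elements.\<close>
lemma split_place_independent: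
  assumes fin: "finite K" and P: "place K F P" "rational_place K P" "P \<noteq> Pinf"
    and split: "bij_betw Pl {..<m} {Q. place K UNIV Q \<and> Q \<inter> F = P}"
    and rat: "\<And>i. i < m \<Longrightarrow> rational_place K (Pl i)"
    and c: "\<And>u. u < m \<Longrightarrow> c u \<in> K"
    and zero: "\<And>i. i < m \<Longrightarrow> (\<Sum>u<m. c u * eval_at K (Pl i) (ymon p r y u)) = 0"
    and u: "u < m"
  shows "c u = 0"
proof -
  have Pl: "place K UNIV (Pl i)" "Pl i \<inter> F = P" if "i < m" for i
    using bij_betwE[OF split] that by auto
  have R: "rational_valued_field K UNIV (Pl i)" if "i < m" for i
    using place_UNIV[OF Pl(1)[OF that]] rat[OF that]
    by (simp add: rational_valued_field_def rational_valued_field_axioms_def)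
  have RP: "rational_valued_field K F P"
    using place_F[OF P(1)] P(2) by (simp add: rational_valued_field_def rational_valued_field_axioms_def)
  let ?B = "\<lambda>i u. eval_at K (Pl i) (ymon p r y u)"
  have yV: "ymon p r y u \<in> Pl i" if "i < m" for i u
    using ymon_regular[OF Pl(1)[OF that]] Pl(2)[OF that] place_ne[OF P(1)] P(3) by auto
  have "\<exists>d. (\<forall>u<m. d u \<in> K) \<and> (\<forall>i<m. (\<Sum>u<m. d u * ?B i u) = (if i = l then 1 else 0))" if l: "l < m" for l
  proof -
    obtain e where e: "\<forall>i\<in>{..<m}. e \<in> Pl i \<and> eval_at K (Pl i) e = (if i = l then 1 else 0)"
      using rational_places_crt[OF fin, of "{..<m}" UNIV Pl l] R bij_betw_imp_inj_on[OF split] l by auto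
    have "e \<in> V" if "place K UNIV V" "V \<inter> F = P" for V
    proof -
      have "V \<in> Pl ` {..<m}" using that bij_betw_imp_surj_on[OF split] by simp
      then show ?thesis using e by auto
    qed
    then obtain a where a: "\<forall>u<m. a u \<in> P" "e = (\<Sum>u<m. a u * ymon p r y u)"
      using integral_over_place[OF P(1,3) Pl[OF l]] by blast
    have "(\<Sum>u<m. eval_at K P (a u) * ?B i u) = (if i = l then 1 else 0)" if i: "i < m" for i
    proof -
      interpret V: rational_valued_field K UNIV "Pl i" using R i by blast
      have aV: "a u \<in> Pl i" if "u < m" for u using a(1) Pl(2)[OF i] that by blast
      \<comment> \<open>The maximal ideal of \<open>P\<close> lies in that of \<open>Pl i\<close>,
        so the residue of a coefficient is the same at all places above \<open>P\<close>.\<close>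
      have "eval_at K (Pl i) (a u) = eval_at K P (a u)" if "u < m" for u
        using rational_valued_field.eval[OF RP, of "a u"] a(1) that
          max_ideal_Int[OF subfield_F, of "Pl i"] Pl(2)[OF i] by (intro V.eval_eqI) auto
      then have "(\<Sum>u<m. eval_at K P (a u) * ?B i u) = eval_at K (Pl i) e"
        unfolding a(2) using aV yV[OF i] by (subst V.eval_sum) (auto simp: V.eval_mult V.V_closed(4))
      then show ?thesis using e i by auto
    qed
    moreover have "\<forall>u<m. eval_at K P (a u) \<in> K" using rational_valued_field.eval(1)[OF RP] a(1) by blast
    ultimately show ?thesis by (intro exI[of _ "\<lambda>u. eval_at K P (a u)"]) auto
  qed
  then obtain d where d: "\<And>l u. l < m \<Longrightarrow> u < m \<Longrightarrow> d l u \<in> K"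
    "\<And>l i. l < m \<Longrightarrow> i < m \<Longrightarrow> (\<Sum>u<m. d l u * ?B i u) = (if i = l then 1 else 0)" by metis
  \<comment> \<open>Row \<open>l\<close> of \<open>d\<close> is dual to the place
    \<open>Pl l\<close>. Adding \<open>c\<close> gives \<open>m + 1\<close> vectors of length
    \<open>m\<close>, hence a dependence \<open>w\<close>. Evaluation at \<open>Pl i\<close>
    isolates \<open>w i\<close>, as \<open>c\<close> evaluates to 0, so only the weight of
    \<open>c\<close> can be nonzero.\<close>
  define A where "A l = (if l = m then c else d l)" for l
  have AK: "A l u \<in> K" if "l \<le> m" "u < m" for l u using that c d(1) by (simp add: A_def)
  obtain w where w: "\<exists>l\<in>{..m}. w l \<noteq> 0" "\<forall>u\<in>{..<m}. (\<Sum>l\<in>{..m}. w l * A l u) = 0"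
    using linear_dependence[OF K, of "{..<m}" "{..m}" A] AK by auto
  have "w i = 0" if i: "i < m" for i
  proof -
    have "0 = (\<Sum>u<m. (\<Sum>l\<le>m. w l * A l u) * ?B i u)" using w(2) by simp
    also have "\<dots> = (\<Sum>l\<le>m. w l * (\<Sum>u<m. A l u * ?B i u))"
      unfolding sum_distrib_left sum_distrib_right by (subst sum.swap) (simp add: mult.assoc)
    also have "\<dots> = (\<Sum>l<m. w l * (\<Sum>u<m. d l u * ?B i u)) + w m * (\<Sum>u<m. c u * ?B i u)"
      by (simp add: lessThan_Suc_atMost[symmetric] A_def)
    also have "\<dots> = (\<Sum>l<m. w l * (if i = l then 1 else 0))" using d(2) i zero by simp
    also have "\<dots> = (\<Sum>l<m. if i = l then w l else 0)" by (intro sum.cong) auto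
    also have "\<dots> = w i" using i by simp
    finally show ?thesis by simp
  qed
  then have "w m \<noteq> 0" "(\<Sum>l<m. w l * A l u) = 0" using w(1) by (auto simp: le_less)
  moreover have "(\<Sum>l<m. w l * A l u) + w m * c u = 0"
    using w(2) u by (simp add: lessThan_Suc_atMost[symmetric] A_def)
  ultimately show ?thesis by simp
qed

text \<open>From left to right this is well-definedness of \<tau> and needs the independence at
  completely split places; from right to left it is injectivity and only substitutes into the
  expansion.\<close>

lemma ev_code_eq_iff_irs_matrix_eq:
  assumes fin: "finite K"
    and P: "\<And>j. j < n \<Longrightarrow> place K F (P j)" "\<And>j. j < n \<Longrightarrow> rational_place K (P j)" "\<And>j. j < n \<Longrightarrow> P j \<noteq> Pinf"
    and split: "\<And>j. j < n \<Longrightarrow> bij_betw (\<lambda>i. Pl i j) {..<m} {Q. place K UNIV Q \<and> Q \<inter> F = P j}"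
    and rat: "\<And>i j. j < n \<Longrightarrow> i < m \<Longrightarrow> rational_place K (Pl i j)"
    and k: "1 \<le> k" "k \<le> n"
    and f: "f \<in> RR_space K ((k - 1) * m) (PinfE 0)" and g: "g \<in> RR_space K ((k - 1) * m) (PinfE 0)"
  shows "ev_code K Pl m n f = ev_code K Pl m n g \<longleftrightarrow>
    irs_matrix K x p r y m k P n f = irs_matrix K x p r y m k P n g"
proof -
  have Pl: "place K UNIV (Pl i j)" "Pl i j \<inter> F = P j" if "i < m" "j < n" for i j
    using bij_betwE[OF split[OF that(2)]] that by auto
  define fs where "fs = coeff_rep K x p r y m k f"
  define gs where "gs = coeff_rep K x p r y m k g"
  \<comment> \<open>At least one \<open>P j\<close> exists, and a place above it is the place away
    from infinity that \<open>coeff_rep\<close> asks for.\<close>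
  have "0 < n" using k by simp
  note Q = Pl[OF m_pos \<open>0 < n\<close>]
  have Q': "place K F (Pl 0 0 \<inter> F)" "Pl 0 0 \<inter> F \<noteq> Pinf" using Q(2) P \<open>0 < n\<close> by auto
  note fs = coeff_rep[OF k(1) Q(1) Q' f, folded fs_def]
  note gs = coeff_rep[OF k(1) Q(1) Q' g, folded gs_def]
  define \<alpha> where "\<alpha> j = eval_at K (P j) x" for j
  define B where "B i j u = eval_at K (Pl i j) (ymon p r y u)" for i j u
  have \<alpha>K: "\<alpha> j \<in> K" if j: "j < n" for j
    unfolding \<alpha>_def using place_F[OF P(1)[OF j]] P(2)[OF j] x_regular[OF P(1)[OF j] P(3)[OF j]]
    by (intro rational_valued_field.eval(1)[of K F])
      (auto simp: rational_valued_field_def rational_valued_field_axioms_def)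
  have ev: "eval_at K (Pl i j) h = (\<Sum>u<m. poly (hs ! u) (\<alpha> j) * B i j u)"
    if i: "i < m" and j: "j < n" and hs: "\<And>u. u < m \<Longrightarrow> hs ! u \<in> poly_over K"
      "h = (\<Sum>u<m. poly (hs ! u) x * ymon p r y u)" for i j h hs
  proof -
    interpret V: rational_valued_field K UNIV "Pl i j"
      using place_UNIV[OF Pl(1)[OF i j]] rat[OF j i]
      by (simp add: rational_valued_field_def rational_valued_field_axioms_def)
    interpret W: rational_valued_field K F "P j"
      using place_F[OF P(1)[OF j]] P(2)[OF j]
      by (simp add: rational_valued_field_def rational_valued_field_axioms_def)
    have xP: "x \<in> P j" using x_regular[OF P(1)[OF j] P(3)[OF j]] .
    then have xV: "x \<in> Pl i j" using Pl(2)[OF i j] by blast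
    have "eval_at K (Pl i j) x = \<alpha> j"
      using W.eval[OF xP] max_ideal_Int[OF subfield_F, of "Pl i j"] Pl(2)[OF i j]
      unfolding \<alpha>_def by (intro V.eval_eqI) auto
    moreover have "ymon p r y u \<in> Pl i j" for u
      using ymon_regular[OF Pl(1)[OF i j]] Pl(2)[OF i j] place_ne[OF P(1)[OF j]] P(3)[OF j] by auto
    ultimately show ?thesis
      unfolding hs(2) B_def using hs(1) V.poly_in_V[OF _ xV]
      by (subst V.eval_sum) (auto simp: V.eval_mult V.V_closed(4) V.eval_poly xV)
  qed
  have evf: "eval_at K (Pl i j) f = (\<Sum>u<m. poly (fs ! u) (\<alpha> j) * B i j u)" if "i < m" "j < n" for i j
    by (rule ev[OF that _ fs(3)]) (rule fs(2))
  have evg: "eval_at K (Pl i j) g = (\<Sum>u<m. poly (gs ! u) (\<alpha> j) * B i j u)" if "i < m" "j < n" for i j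
    by (rule ev[OF that _ gs(3)]) (rule gs(2))
  have irs: "irs_matrix K x p r y m k P n f = irs_matrix K x p r y m k P n g \<longleftrightarrow>
      (\<forall>u<m. \<forall>j<n. poly (fs ! u) (\<alpha> j) = poly (gs ! u) (\<alpha> j))"
    unfolding irs_matrix_def Let_def fs_def gs_def \<alpha>_def by auto
  show ?thesis
    unfolding ev_code_eq_iff irs
  proof (intro iffI allI impI)
    fix i j assume ij: "i < m" "j < n" and eq: "\<forall>u<m. \<forall>j<n. poly (fs ! u) (\<alpha> j) = poly (gs ! u) (\<alpha> j)"
    show "eval_at K (Pl i j) f = eval_at K (Pl i j) g"
      unfolding evf[OF ij] evg[OF ij] using eq ij by (intro sum.cong) auto
  next
    fix u j assume u: "u < m" and j: "j < n"
      and eq: "\<forall>j<n. \<forall>i<m. eval_at K (Pl i j) f = eval_at K (Pl i j) g"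
    have "poly (fs ! u) (\<alpha> j) - poly (gs ! u) (\<alpha> j) = 0"
    proof (rule split_place_independent[OF fin P(1)[OF j] P(2)[OF j] P(3)[OF j] split[OF j] rat[OF j] _ _ u])
      fix v assume "v < m"
      then show "poly (fs ! v) (\<alpha> j) - poly (gs ! v) (\<alpha> j) \<in> K"
        using fs(2) gs(2) \<alpha>K[OF j] by (intro subfield_closed(7)[OF K] poly_in_subfield[OF K])
    next
      fix i assume i: "i < m"
      have "(\<Sum>u<m. poly (fs ! u) (\<alpha> j) * B i j u) = (\<Sum>u<m. poly (gs ! u) (\<alpha> j) * B i j u)"
        using eq evf[OF i j] evg[OF i j] i j by simp
      then show "(\<Sum>u<m. (poly (fs ! u) (\<alpha> j) - poly (gs ! u) (\<alpha> j)) * eval_at K (Pl i j) (ymon p r y u)) = 0"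
        by (simp add: B_def left_diff_distrib sum_subtractf)
    qed
    then show "poly (fs ! u) (\<alpha> j) = poly (gs ! u) (\<alpha> j)" by simp
  qed
qed

end

section \<open>From equal fibres to the bijection\<close>

text \<open>Maps with the same fibres on \<open>A\<close> have images in natural bijection. Any
  preimage chosen by \<open>SOME\<close> gives the same result, and surjectivity is automatic
  because the target is an image too.\<close>

lemma bij_betw_images_same_fibres:
  assumes "\<And>f g. f \<in> A \<Longrightarrow> g \<in> A \<Longrightarrow> u f = u g \<longleftrightarrow> v f = v g"
  shows "bij_betw (\<lambda>c. v (SOME f. f \<in> A \<and> u f = c)) (u ` A) (v ` A)"
proof -
  have *: "v (SOME g. g \<in> A \<and> u g = u f) = v f" if "f \<in> A" for f
    using someI[of "\<lambda>g. g \<in> A \<and> u g = u f" f] that assms by blast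
  show ?thesis
    unfolding bij_betw_def
  proof
    show "inj_on (\<lambda>c. v (SOME f. f \<in> A \<and> u f = c)) (u ` A)"
      using assms by (auto simp: inj_on_def *)
    show "(\<lambda>c. v (SOME f. f \<in> A \<and> u f = c)) ` u ` A = v ` A"
      by (auto simp: image_image *)
  qed
qed

theorem mainTheorem6:
  fixes K :: "'e::field set" and x :: 'e and m r n k :: nat and p :: "nat \<Rightarrow> nat"
    and Et :: "nat \<Rightarrow> 'e set" and y :: "nat \<Rightarrow> 'e"
    and P :: "nat \<Rightarrow> 'e set" and Pl :: "nat \<Rightarrow> nat \<Rightarrow> 'e set"
    and F Pinf :: "'e set" and PinfE :: "nat \<Rightarrow> 'e set" and lam :: nat
  defines "F \<equiv> rat_fun_field K x"
    and "Pinf \<equiv> pole_place K F x"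
    and "PinfE \<equiv> (\<lambda>i. place_above K (Et i) Pinf F)"
    and "lam \<equiv> (k - 1) * m"
  assumes K: "subfield K" "finite K" "full_constant_field K"
    and x: "\<not> algebraic_over K x"
    and deg: "ext_degree_is F UNIV m"
    and mprod: "m = (\<Prod>i<r. p i)"
    and P1: "totally_ramified K F UNIV Pinf m"
    and P2: "Et 0 = UNIV" "Et r = F"
      "\<forall>i<r. Et (Suc i) \<subset> Et i \<and> galois_of_degree (Et (Suc i)) (Et i) (p i)"
    and P3: "\<forall>i<r. y i \<in> Et i \<and> Et i = adjoin (Et (Suc i)) (y i)
        \<and> y i \<notin> PinfE i \<and> (\<forall>V. place K (Et i) V \<and> V \<noteq> PinfE i \<longrightarrow> y i \<in> V)
        \<and> gcd (val (PinfE i) (y i)) (int (p i)) = 1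
        \<and> (\<forall>Q. place K (Et (Suc i)) Q \<and> Q \<noteq> PinfE (Suc i) \<longrightarrow>
              int_closure K (Et i) (Et (Suc i)) Q
                = {\<Sum>j<p i. a j * y i ^ j | a. \<forall>j<p i. a j \<in> Q})"
    and P4: "inj_on P {..<n}"
      "\<forall>j<n. place K F (P j) \<and> rational_place K (P j) \<and> P j \<noteq> Pinf"
      "\<forall>j<n. bij_betw (\<lambda>i. Pl i j) {..<m} {Q. place K UNIV Q \<and> Q \<inter> F = P j}
              \<and> (\<forall>i<m. rational_place K (Pl i j))"
    and k: "1 \<le> k" "k \<le> n"
  shows "(\<forall>f\<in>RR_space K lam (PinfE 0). \<forall>g\<in>RR_space K lam (PinfE 0).
            ev_code K Pl m n f = ev_code K Pl m n g \<longrightarrow>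
            irs_matrix K x p r y m k P n f = irs_matrix K x p r y m k P n g)
      \<and> bij_betw
          (\<lambda>c. irs_matrix K x p r y m k P n
                 (SOME f. f \<in> RR_space K lam (PinfE 0) \<and> ev_code K Pl m n f = c))
          (ev_code K Pl m n ` RR_space K lam (PinfE 0))
          (irs_matrix K x p r y m k P n ` RR_space K lam (PinfE 0))"
proof -
  note finK = K(2)
  interpret rational_field K x using K(1) x by unfold_locales
  interpret infinity_tower K x m r p Et
  proof
    show "ext_degree_is (Et (Suc i)) (Et i) (p i)" if "i < r" for i
      using P2(3) that by (simp add: galois_of_degree_def)
  qed (use mprod P1 P2(1,2) in \<open>simp_all add: F_def Pinf_def\<close>)
  \<comment> \<open>The assumptions on the \<open>y i\<close> speak of \<open>PinfE\<close>. They
    can be used only now that total ramification has identified these descriptions with the concrete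
    rings \<open>Vinf\<close>.\<close>
  have PinfE: "PinfE i = Vinf i" if "i \<le> r" for i
    using PinfE_eq[OF that] unfolding PinfE_def Pinf_def F_def .
  interpret integral_tower K x m r p Et y
  proof
    fix i assume i: "i < r"
    then have E: "PinfE i = Vinf i" "PinfE (Suc i) = Vinf (Suc i)" using PinfE by auto
    note P3i = P3[rule_format, OF i, unfolded E]
    show "y i \<in> Et i" "y i \<notin> Vinf i" using P3i by blast+
    show "coprime (val (Vinf i) (y i)) (int (p i))" using P3i by (simp add: coprime_iff_gcd_eq_1)
    show "y i \<in> V" if "place K (Et i) V" "V \<noteq> Vinf i" for V using P3i that by blast
    show "int_closure K (Et i) (Et (Suc i)) Q = {\<Sum>j<p i. a j * y i ^ j | a. \<forall>j<p i. a j \<in> Q}"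
      if "place K (Et (Suc i)) Q" "Q \<noteq> Vinf (Suc i)" for Q using P3i that by blast
  qed
  have iff: "ev_code K Pl m n f = ev_code K Pl m n g \<longleftrightarrow>
      irs_matrix K x p r y m k P n f = irs_matrix K x p r y m k P n g"
    if "f \<in> RR_space K lam (PinfE 0)" "g \<in> RR_space K lam (PinfE 0)" for f g
    using that P4 k finK unfolding lam_def PinfE_def Pinf_def F_def
    by (intro ev_code_eq_iff_irs_matrix_eq) auto
  show ?thesis
    by (intro conjI ballI impI bij_betw_images_same_fibres) (simp_all add: iff)
qed

end
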